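(* Let $n\geq 3$ and let $G\in\mathcal{G}_{2n}$ with $F(G)=n-1$. Then $G$ is $1$-extendable but not $2$-extendable if and only if $G$ has a perfect matching $M=\{u_iv_i : i=1,\dots,n\}$ with $f(G,M)=n-1$ such that one of the following holds: (i) $n\geq 4$, the induced subgraph $G[\{v_1,\dots,v_n\}]$ is the disjoint union of one triangle and $n-3$ isolated vertices, and $G[\{u_1,\dots,u_n\}]$ contains at least two independent (disjoint) edges; (ii) $\{v_1,\dots,v_{n-1}\}$ is an independent set of $G$, $G[\{u_1,\dots,u_n,v_n\}]$ contains at least two independent edges, and $\{v_iv_n,\ v_ju_n\}\subseteq E(G)$ for some $i,j$ with $1\leq i,j\leq n-1$.
   Context: All graphs are finite and simple. $\mathcal{G}_{2n}$ denotes the set of all graphs with $2n$ vertices that have a perfect matching. For a perfect matching $M$ of $G$, a forcing set of $M$ is a subset $S\subseteq M$ contained in no other perfect matching of $G$; $f(G,M)$ is the minimum size of a forcing set of $M$, and $F(G)$ is the maximum of $f(G,M)$ over all perfect matchings $M$. For an integer $l\ge 0$, a connected graph with at least $2l+2$ vertices is $l$-extendable if it has a perfect matching and every matching of size $l$ is contained in a perfect matching. *)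

theory Defs
  imports Main
begin

definition simple_graph :: "'a set \<Rightarrow> 'a set set \<Rightarrow> bool" where
  "simple_graph V E \<longleftrightarrow> finite V \<and> (\<forall>e\<in>E. \<exists>x y. x \<in> V \<and> y \<in> V \<and> x \<noteq> y \<and> e = {x, y})"

definition matching :: "'a set set \<Rightarrow> 'a set set \<Rightarrow> bool" where
  "matching E M \<longleftrightarrow> M \<subseteq> E \<and> (\<forall>e1\<in>M. \<forall>e2\<in>M. e1 \<noteq> e2 \<longrightarrow> e1 \<inter> e2 = {})"

definition perfect_matching :: "'a set \<Rightarrow> 'a set set \<Rightarrow> 'a set set \<Rightarrow> bool" where
  "perfect_matching V E M \<longleftrightarrow> matching E M \<and> \<Union>M = V"

definition has_perfect_matching :: "'a set \<Rightarrow> 'a set set \<Rightarrow> bool" where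
  "has_perfect_matching V E \<longleftrightarrow> (\<exists>M. perfect_matching V E M)"

definition forcing_set :: "'a set \<Rightarrow> 'a set set \<Rightarrow> 'a set set \<Rightarrow> 'a set set \<Rightarrow> bool" where
  "forcing_set V E M S \<longleftrightarrow> S \<subseteq> M \<and>
     (\<forall>M'. perfect_matching V E M' \<and> S \<subseteq> M' \<longrightarrow> M' = M)"

definition forcing_number :: "'a set \<Rightarrow> 'a set set \<Rightarrow> 'a set set \<Rightarrow> nat" where
  "forcing_number V E M = Min {card S | S. forcing_set V E M S}"

definition max_forcing_number :: "'a set \<Rightarrow> 'a set set \<Rightarrow> nat" where
  "max_forcing_number V E = Max {forcing_number V E M | M. perfect_matching V E M}"

definition connected_graph :: "'a set \<Rightarrow> 'a set set \<Rightarrow> bool" where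
  "connected_graph V E \<longleftrightarrow> (\<forall>x\<in>V. \<forall>y\<in>V. (\<lambda>a b. {a, b} \<in> E)\<^sup>*\<^sup>* x y)"

definition extendable :: "nat \<Rightarrow> 'a set \<Rightarrow> 'a set set \<Rightarrow> bool" where
  "extendable l V E \<longleftrightarrow> connected_graph V E \<and> card V \<ge> 2 * l + 2 \<and>
     has_perfect_matching V E \<and>
     (\<forall>N. matching E N \<and> card N = l \<longrightarrow> (\<exists>M. perfect_matching V E M \<and> N \<subseteq> M))"

definition two_indep_edges_in :: "'a set set \<Rightarrow> 'a set \<Rightarrow> bool" where
  "two_indep_edges_in E U \<longleftrightarrow>
     (\<exists>e1\<in>E. \<exists>e2\<in>E. e1 \<subseteq> U \<and> e2 \<subseteq> U \<and> e1 \<inter> e2 = {})"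

definition independent_set :: "'a set set \<Rightarrow> 'a set \<Rightarrow> bool" where
  "independent_set E U \<longleftrightarrow> (\<forall>e\<in>E. \<not> e \<subseteq> U)"

definition induced_edges :: "'a set set \<Rightarrow> 'a set \<Rightarrow> 'a set set" where
  "induced_edges E U = {e \<in> E. e \<subseteq> U}"

end

theory Submission
  imports Defs
begin

text \<open>A perfect matching \<open>M\<close> of a graph on \<open>2n\<close> vertices has forcing number \<open>n - 1\<close> exactly when any
  two of its edges lie on a common \<open>M\<close>-alternating 4-cycle. Remove the endpoints of one or two disjoint
  edges. The partners of these endpoints become exposed, and each of them is adjacent to at least one
  end of every remaining matching edge. If no augmentation is possible, then the exposed vertices pick
  the same ends everywhere, and what they avoid forms a transversal \<open>W\<close> of \<open>M\<close>. For one edge, \<open>W\<close> is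
  independent. For two edges, either \<open>W\<close> becomes independent when one vertex is omitted, or any two
  edges inside \<open>W\<close> meet, so that they form a star, which also leaves an independent set when its centre
  is omitted, or a triangle. Conversely, counting partners of the isolated vertices of \<open>W\<close> shows that
  two disjoint edges outside \<open>W\<close> cannot be extended.\<close>

text \<open>Say that a vertex sees its neighbours. The delicate case is that of two edges none of
  whose endpoints are partners of each other: four vertices are then exposed, and they need not
  agree on the ends they see. A disagreement, \<open>p\<close> seeing \<open>z\<close> while
  \<open>q\<close> sees \<open>mt z\<close>, is turned into information: using both of these edges
  leaves two exposed vertices over a smaller closed set, again without a perfect matching, so the
  rigid structure for two exposed vertices applies there. Disagreements at different pairs give
  overlapping structures that are glued together.

  In the other direction, \<open>1\<close>-extendability comes from excluding independent
  transversals. In (i), a vertex of \<open>W\<close> off the triangle forces such a transversal to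
  be \<open>W\<close> or its complement, which the triangle and an edge outside \<open>W\<close>
  forbid. In (ii), the edges from \<open>v i\<close> to \<open>v n\<close> and from
  \<open>v j\<close> to \<open>u n\<close> exclude transversals containing all of
  \<open>v 1\<close>, ..., \<open>v (n - 1)\<close>, and the two independent edges exclude those
  containing all of \<open>u 1\<close>, ..., \<open>u (n - 1)\<close>.\<close>

text \<open>The function \<open>mt\<close> sends a vertex to its partner in the fixed perfect matching. The assumption
  \<open>square\<close> is the 4-cycle condition equivalent to forcing number \<open>n - 1\<close>.\<close>

locale square_matching =
  fixes V :: "'a set" and E :: "'a set set" and mt :: "'a \<Rightarrow> 'a"
  assumes simple: "simple_graph V E"
    and mt_in: "x \<in> V \<Longrightarrow> mt x \<in> V"
    and mt_mt: "x \<in> V \<Longrightarrow> mt (mt x) = x"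
    and mt_edge: "x \<in> V \<Longrightarrow> {x, mt x} \<in> E"
    and square: "x \<in> V \<Longrightarrow> y \<in> V \<Longrightarrow> y \<noteq> x \<Longrightarrow> y \<noteq> mt x \<Longrightarrow>
      {x, y} \<in> E \<and> {mt x, mt y} \<in> E \<or> {x, mt y} \<in> E \<and> {mt x, y} \<in> E"
begin

section \<open>Partners, closed sets and gluing of matchings\<close>

definition adj :: "'a \<Rightarrow> 'a \<Rightarrow> bool" where
  "adj x y \<longleftrightarrow> {x, y} \<in> E"

text \<open>Only existence is recorded: matchings of disjoint pieces are glued again and again, and
  no argument needs to know which edges they use.\<close>

definition pm :: "'a set \<Rightarrow> bool" where
  "pm A \<longleftrightarrow> has_perfect_matching A E"

definition closed :: "'a set \<Rightarrow> bool" where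
  "closed S \<longleftrightarrow> S \<subseteq> V \<and> (\<forall>x\<in>S. mt x \<in> S)"

definition indep :: "'a set \<Rightarrow> bool" where
  "indep A \<longleftrightarrow> (\<forall>x\<in>A. \<forall>y\<in>A. \<not> adj x y)"

lemma finite_V: "finite V"
  using simple by (simp add: simple_graph_def)

lemma adj_sym: "adj x y \<Longrightarrow> adj y x"
  by (simp add: adj_def insert_commute)

lemma edgeE:
  assumes "e \<in> E"
  obtains x y where "x \<in> V" "y \<in> V" "x \<noteq> y" "e = {x, y}" "adj x y"
proof -
  obtain x y where "x \<in> V" "y \<in> V" "x \<noteq> y" "e = {x, y}"
    using assms simple unfolding simple_graph_def by blast
  then show ?thesis using assms that by (simp add: adj_def)
qed

lemma adj_D:
  assumes "adj x y"
  shows "x \<in> V" "y \<in> V" "x \<noteq> y"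
proof -
  from assms have "{x, y} \<in> E" by (simp add: adj_def)
  then obtain a b where "a \<in> V" "b \<in> V" "a \<noteq> b" "{x, y} = {a, b}" by (rule edgeE)
  then show "x \<in> V" "y \<in> V" "x \<noteq> y" by (auto simp: doubleton_eq_iff)
qed

lemma indep_iff: "indep A \<longleftrightarrow> independent_set E A"
proof
  assume A: "indep A"
  show "independent_set E A"
    unfolding independent_set_def
  proof
    fix e assume "e \<in> E"
    then obtain x y where "e = {x, y}" "adj x y" by (rule edgeE)
    then show "\<not> e \<subseteq> A" using A by (auto simp: indep_def)
  qed
next
  assume "independent_set E A"
  then show "indep A" unfolding indep_def independent_set_def adj_def by fastforce
qed

lemma mt_neq: "x \<in> V \<Longrightarrow> mt x \<noteq> x"
  using adj_D(3)[of x "mt x"] mt_edge[of x] unfolding adj_def by metis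

lemma mt_inj: "x \<in> V \<Longrightarrow> y \<in> V \<Longrightarrow> mt x = mt y \<longleftrightarrow> x = y"
  by (metis mt_mt)

lemma mt_swap: "x \<in> V \<Longrightarrow> y \<in> V \<Longrightarrow> mt x = y \<longleftrightarrow> x = mt y"
  by (metis mt_mt)

lemma inj_on_mt: "A \<subseteq> V \<Longrightarrow> inj_on mt A"
  using mt_inj by (auto intro!: inj_onI)

lemma square_adj:
  assumes "x \<in> V" "y \<in> V" "y \<noteq> x" "y \<noteq> mt x"
  shows "adj x y \<and> adj (mt x) (mt y) \<or> adj x (mt y) \<and> adj (mt x) y"
  using square[OF assms] by (simp add: adj_def)

lemma perfect_matching_Un:
  assumes P: "perfect_matching A E P" and Q: "perfect_matching B E Q" and "A \<inter> B = {}"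
  shows "perfect_matching (A \<union> B) E (P \<union> Q)"
  unfolding perfect_matching_def matching_def
proof (intro conjI ballI impI)
  show "P \<union> Q \<subseteq> E" "\<Union>(P \<union> Q) = A \<union> B"
    using P Q by (auto simp: perfect_matching_def matching_def)
  fix e1 e2 assume e: "e1 \<in> P \<union> Q" "e2 \<in> P \<union> Q" "e1 \<noteq> e2"
  have "e \<subseteq> A" if "e \<in> P" for e using that P by (auto simp: perfect_matching_def)
  moreover have "e \<subseteq> B" if "e \<in> Q" for e using that Q by (auto simp: perfect_matching_def)
  moreover have "e1 \<inter> e2 = {}" if "e1 \<in> P \<and> e2 \<in> P \<or> e1 \<in> Q \<and> e2 \<in> Q"
    using that P Q e(3) unfolding perfect_matching_def matching_def by metis
  ultimately show "e1 \<inter> e2 = {}" using e assms(3) by fastforce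
qed

lemma pm_Un:
  assumes "pm A" "pm B" "A \<inter> B = {}"
  shows "pm (A \<union> B)"
proof -
  obtain P Q where P: "perfect_matching A E P" and Q: "perfect_matching B E Q"
    using assms by (auto simp: pm_def has_perfect_matching_def)
  have "perfect_matching (A \<union> B) E (P \<union> Q)"
    using P Q assms(3) by (intro perfect_matching_Un)
  then show ?thesis by (auto simp: pm_def has_perfect_matching_def)
qed

lemma pm_pair: "adj x y \<Longrightarrow> pm {x, y}"
  unfolding pm_def has_perfect_matching_def perfect_matching_def matching_def adj_def
  by (rule exI[of _ "{{x, y}}"]) simp

lemma perfect_matching_closed:
  assumes "closed S"
  shows "perfect_matching S E ((\<lambda>x. {x, mt x}) ` S)"
proof -
  have *: "x \<in> V" "mt x \<in> S" if "x \<in> S" for x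
    using that assms by (auto simp: closed_def)
  have "{x, mt x} = {y, mt y}" if "x \<in> S" "y \<in> S" "{x, mt x} \<inter> {y, mt y} \<noteq> {}" for x y
  proof -
    have "y = x \<or> y = mt x"
      using that(3) mt_inj[of x y] mt_swap[of x y] * that(1,2) by auto
    then show ?thesis using mt_mt[of x] * that(1) by auto
  qed
  then have "\<forall>e1\<in>(\<lambda>x. {x, mt x}) ` S. \<forall>e2\<in>(\<lambda>x. {x, mt x}) ` S. e1 \<noteq> e2 \<longrightarrow> e1 \<inter> e2 = {}"
    by blast
  moreover have "(\<lambda>x. {x, mt x}) ` S \<subseteq> E" using * mt_edge by blast
  moreover have "\<Union>((\<lambda>x. {x, mt x}) ` S) = S" using * by blast
  ultimately show ?thesis unfolding perfect_matching_def matching_def by blast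
qed

lemma pm_closed: "closed S \<Longrightarrow> pm S"
  using perfect_matching_closed by (auto simp: pm_def has_perfect_matching_def)

lemma pm_complete:
  assumes "finite A" "finite B" "card A = card B" "A \<inter> B = {}"
    and adj: "\<And>a b. a \<in> A \<Longrightarrow> b \<in> B \<Longrightarrow> adj a b"
  shows "pm (A \<union> B)"
proof -
  obtain f where f: "bij_betw f A B"
    using assms(1-3) by (metis finite_same_card_bij)
  then have fB: "f a \<in> B" if "a \<in> A" for a using that by (auto simp: bij_betw_def)
  let ?P = "(\<lambda>a. {a, f a}) ` A"
  have UP: "\<Union>?P = A \<union> B" using f by (auto simp: bij_betw_def)
  have PE: "?P \<subseteq> E" using adj fB by (auto simp: adj_def)
  have disj: "{a, f a} \<inter> {b, f b} = {}" if "a \<in> A" "b \<in> A" "a \<noteq> b" for a b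
  proof -
    have "f a \<noteq> f b" using f that by (auto simp: bij_betw_def inj_on_def)
    moreover have "a \<noteq> f b" "f a \<noteq> b" using fB that assms(4) by blast+
    ultimately show ?thesis using that(3) by auto
  qed
  have "e1 \<inter> e2 = {}" if e: "e1 \<in> ?P" "e2 \<in> ?P" "e1 \<noteq> e2" for e1 e2
  proof -
    obtain a b where "a \<in> A" "b \<in> A" "e1 = {a, f a}" "e2 = {b, f b}" using e by blast
    moreover from this have "a \<noteq> b" using e(3) by auto
    ultimately show ?thesis using disj by simp
  qed
  with PE UP have "perfect_matching (A \<union> B) E ?P"
    unfolding perfect_matching_def matching_def by simp
  then show ?thesis by (auto simp: pm_def has_perfect_matching_def)
qed

lemma closed_diff_pair:
  assumes "closed S" "z \<in> V"
  shows "closed (S - {z, mt z})"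
  unfolding closed_def
proof (intro conjI ballI)
  fix x assume x: "x \<in> S - {z, mt z}"
  then have "x \<in> V" "mt x \<in> S" using assms(1) by (auto simp: closed_def)
  moreover have "mt x \<noteq> z" "mt x \<noteq> mt z"
    using x mt_swap[OF \<open>x \<in> V\<close> assms(2)] mt_inj[OF \<open>x \<in> V\<close> assms(2)] by auto
  ultimately show "mt x \<in> S - {z, mt z}" by blast
qed (use assms in \<open>auto simp: closed_def\<close>)

text \<open>After matching \<open>Q\<close> internally, the unmatched part of \<open>R\<close> is matched with the partners that
  the vertices of \<open>Q - R\<close> have lost.\<close>

lemma pm_switch:
  assumes S: "closed S" and R: "finite R" "R \<inter> S = {}"
    and Q: "pm Q" "Q \<subseteq> R \<union> S" "card Q = card R" "Q \<inter> mt ` (Q - R) = {}"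
    and adj: "\<And>r y. r \<in> R - Q \<Longrightarrow> y \<in> Q - R \<Longrightarrow> adj r (mt y)"
  shows "pm (R \<union> S)"
proof -
  let ?Q = "Q - R" and ?B = "mt ` (Q - R)"
  have QS: "?Q \<subseteq> S" using Q(2) by blast
  have SV: "S \<subseteq> V" and mtS: "\<And>x. x \<in> S \<Longrightarrow> mt x \<in> S" using S by (auto simp: closed_def)
  have BS: "?B \<subseteq> S" using QS mtS by blast
  have fS: "finite S" using SV finite_V finite_subset by blast
  then have fQ: "finite Q" using R(1) Q(2) finite_subset by blast
  have "card ?B = card ?Q" using QS SV by (intro card_image inj_on_mt) auto
  also have "\<dots> = card (R - Q)"
    using Q(3) fQ R(1) by (metis card_Diff_subset_Int finite_Int inf_commute)
  finally have "card (R - Q) = card ?B" by simp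
  then have 1: "pm ((R - Q) \<union> ?B)"
    using R fQ adj BS by (intro pm_complete) auto
  \<comment> \<open>\<open>?B\<close> consists of the partners of \<open>?Q\<close>, so whole pairs
    are removed and the rest keeps its old matching.\<close>
  have "closed (S - (?Q \<union> ?B))"
    unfolding closed_def
  proof (intro conjI ballI)
    show "S - (?Q \<union> ?B) \<subseteq> V" using SV by blast
    fix x assume x: "x \<in> S - (?Q \<union> ?B)"
    then have xV: "x \<in> V" using SV by blast
    have "mt x \<notin> ?Q" using x mt_mt[OF xV] by (metis DiffD2 UnI2 image_eqI)
    moreover have "mt x \<notin> ?B"
    proof
      assume "mt x \<in> ?B"
      then obtain y where "y \<in> ?Q" "mt x = mt y" by blast
      moreover from this have "y \<in> V" using QS SV by blast
      ultimately show False using x mt_inj[OF xV] by auto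
    qed
    ultimately show "mt x \<in> S - (?Q \<union> ?B)" using x mtS by blast
  qed
  then have 2: "pm (S - (?Q \<union> ?B))" by (rule pm_closed)
  have "pm (Q \<union> ((R - Q) \<union> ?B))" using BS QS R(2) Q(4) by (intro pm_Un[OF Q(1) 1]) blast
  then have "pm ((Q \<union> ((R - Q) \<union> ?B)) \<union> (S - (?Q \<union> ?B)))"
    using R(2) by (intro pm_Un[OF _ 2]) blast+
  moreover have "(Q \<union> ((R - Q) \<union> ?B)) \<union> (S - (?Q \<union> ?B)) = R \<union> S"
    using Q(2) BS by blast
  ultimately show ?thesis by simp
qed

section \<open>Two exposed vertices\<close>

text \<open>The alternating 4-cycle through the matching edges at \<open>p\<close> and at
  \<open>z\<close> leaves \<open>p\<close> along an edge to \<open>z\<close> or to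
  \<open>mt z\<close>. Closedness of \<open>S\<close> makes the two matching edges distinct.\<close>

lemma adj_or:
  assumes "closed S" "z \<in> S" "p \<in> V" "p \<notin> S"
  shows "adj p z \<or> adj p (mt z)"
proof -
  have "z \<in> V" "mt z \<in> S" using assms by (auto simp: closed_def)
  moreover have "z \<noteq> p" "z \<noteq> mt p" using assms calculation mt_mt by auto
  ultimately show ?thesis using square_adj[of p z] assms by blast
qed

text \<open>Augmentation along the path \<open>p\<close>, \<open>z\<close>, \<open>mt z\<close>,
  \<open>q\<close>.\<close>

lemma pm_pair_switch:
  assumes S: "closed S" and "p \<notin> S" "q \<notin> S" "p \<noteq> q" "z \<in> S" "adj p z" "adj q (mt z)"
  shows "pm ({p, q} \<union> S)"
proof (rule pm_switch[OF S, where Q = "{p, z}"])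
  have "z \<in> V" using S assms by (auto simp: closed_def)
  then have "mt z \<noteq> z" by (rule mt_neq)
  have "mt z \<in> S" using S assms by (auto simp: closed_def)
  then show "{p, z} \<inter> mt ` ({p, z} - {p, q}) = {}" using assms \<open>mt z \<noteq> z\<close> by auto
  have "z \<noteq> p" using assms by blast
  then show "card {p, z} = card {p, q}" using assms(4) by simp
  show "pm {p, z}" using assms(6) by (rule pm_pair)
  show "adj r (mt y)" if "r \<in> {p, q} - {p, z}" "y \<in> {p, z} - {p, q}" for r y
    using that assms(7) by blast
  show "finite {p, q}" "{p, q} \<inter> S = {}" "{p, z} \<subseteq> {p, q} \<union> S" using assms by simp_all
qed

text \<open>Each of \<open>p\<close> and \<open>q\<close> sees at least one end of every pair in
  \<open>S\<close>. If they saw opposite ends, the pair would augment; hence both see exactly one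
  end, and the same one. The unseen ends are the independent half.\<close>

lemma no_pm_two:
  assumes S: "closed S" and pq: "p \<in> V" "q \<in> V" "p \<notin> S" "q \<notin> S" "p \<noteq> q"
    and no: "\<not> pm ({p, q} \<union> S)"
  shows "\<And>z. z \<in> S \<Longrightarrow> adj p z \<longleftrightarrow> \<not> adj p (mt z)"
    and "\<And>z. z \<in> S \<Longrightarrow> adj q z \<longleftrightarrow> adj p z"
    and "indep ({p, q} \<union> {z \<in> S. \<not> adj p z})"
proof -
  have mtS: "mt z \<in> S" "z \<in> V" "mt (mt z) = z" if "z \<in> S" for z
    using S that by (auto simp: closed_def mt_mt subset_iff)
  have npq: "\<not> adj p q"
  proof
    assume "adj p q"
    then have "pm ({p, q} \<union> S)" using pm_Un[OF pm_pair pm_closed[OF S]] pq by auto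
    then show False using no by simp
  qed
  have or: "adj p z \<or> adj p (mt z)" "adj q z \<or> adj q (mt z)" if "z \<in> S" for z
    using adj_or S that pq by blast+
  have x: "\<not> (adj p z \<and> adj q (mt z))" if "z \<in> S" for z
    using pm_pair_switch[OF S, of p q z] that pq no by blast
  have x': "\<not> (adj q z \<and> adj p (mt z))" if "z \<in> S" for z
    using x[of "mt z"] mtS[OF that] by auto
  show 1: "adj p z \<longleftrightarrow> \<not> adj p (mt z)" if "z \<in> S" for z
    using or x x' that by blast
  show 2: "adj q z \<longleftrightarrow> adj p z" if "z \<in> S" for z
    using or x x' that by blast
  \<comment> \<open>Otherwise \<open>p\<close>, \<open>mt y\<close>, \<open>y\<close>,
    \<open>z\<close>, \<open>mt z\<close>, \<open>q\<close> is an augmenting path.\<close>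
  have 3: "\<not> adj y z" if "y \<in> S" "z \<in> S" "\<not> adj p y" "\<not> adj p z" for y z
  proof
    assume a: "adj y z"
    have "pm ({p, q} \<union> S)"
    proof (rule pm_switch[OF S, where Q = "{y, z}"])
      have "y \<noteq> z" using a adj_D by blast
      then show "card {y, z} = card {p, q}" using pq by simp
      have "adj p (mt y)" "adj p (mt z)" using 1 that by auto
      then show "{y, z} \<inter> mt ` ({y, z} - {p, q}) = {}"
        using that by auto
      show "adj r (mt x)" if "r \<in> {p, q} - {y, z}" "x \<in> {y, z} - {p, q}" for r x
        using that \<open>adj p (mt y)\<close> \<open>adj p (mt z)\<close> 2[of "mt y"] 2[of "mt z"] mtS \<open>y \<in> S\<close> \<open>z \<in> S\<close> by auto
      show "pm {y, z}" using a by (rule pm_pair)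
      show "finite {p, q}" "{p, q} \<inter> S = {}" "{y, z} \<subseteq> {p, q} \<union> S" using that pq by simp_all
    qed
    then show False using no by simp
  qed
  have "\<not> adj p p" "\<not> adj q q" "\<not> adj q p" using adj_D(3) adj_sym npq by blast+
  then show "indep ({p, q} \<union> {z \<in> S. \<not> adj p z})"
    unfolding indep_def using npq 2 3 adj_sym by blast
qed

section \<open>Transversals and four exposed vertices\<close>

text \<open>These sets are the candidates for the set of all \<open>v i\<close>; their complements
  are then the sets of all \<open>u i\<close>.\<close>

definition transversal :: "'a set \<Rightarrow> bool" where
  "transversal W \<longleftrightarrow> W \<subseteq> V \<and> (\<forall>x\<in>V. x \<in> W \<longleftrightarrow> mt x \<notin> W)"

text \<open>Stated through \<open>adj\<close>, which excludes loops, so that \<open>a\<close>,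
  \<open>b\<close>, \<open>c\<close> are automatically distinct; \<open>one_triangle_iff\<close>
  gives the form with induced edges.\<close>

definition one_triangle :: "'a set \<Rightarrow> bool" where
  "one_triangle W \<longleftrightarrow> (\<exists>a b c. a \<in> W \<and> b \<in> W \<and> c \<in> W \<and> adj a b \<and> adj b c \<and> adj a c \<and>
     (\<forall>x\<in>W. \<forall>y\<in>W. adj x y \<longrightarrow> {x, y} \<subseteq> {a, b, c}))"

text \<open>Suppose that no vertex meets all edges. Starting from an edge \<open>ab\<close>, an edge
  missing \<open>a\<close> must use \<open>b\<close> and yields \<open>bc\<close>; an edge missing
  \<open>b\<close> must meet both and is therefore \<open>ac\<close>. Any further edge meets all
  three sides, so it lies inside the triangle.\<close>

lemma star_or_triangle:
  assumes "W \<noteq> {}"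
    and meet: "\<And>x y u v. x \<in> W \<Longrightarrow> y \<in> W \<Longrightarrow> u \<in> W \<Longrightarrow> v \<in> W \<Longrightarrow> adj x y \<Longrightarrow> adj u v \<Longrightarrow>
      {x, y} \<inter> {u, v} \<noteq> {}"
  shows "(\<exists>t\<in>W. indep (W - {t})) \<or> one_triangle W"
proof (cases "\<exists>t\<in>W. indep (W - {t})")
  case False
  from assms(1) False obtain a b where ab: "a \<in> W" "b \<in> W" "adj a b"
    unfolding indep_def by blast
  then have "a \<noteq> b" using adj_D by blast
  from ab(1) False obtain u v where uv: "u \<in> W - {a}" "v \<in> W - {a}" "adj u v"
    unfolding indep_def by blast
  have "u = b \<or> v = b" using meet[of a b u v] ab uv by auto
  then obtain c where bc: "c \<in> W" "c \<noteq> a" "adj b c" using uv adj_sym by blast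
  then have "b \<noteq> c" using adj_D by blast
  from ab(2) False obtain x y where xy: "x \<in> W - {b}" "y \<in> W - {b}" "adj x y"
    unfolding indep_def by blast
  have "x = a \<or> y = a" using meet[of a b x y] ab xy by auto
  moreover have "x = c \<or> y = c" using meet[of b c x y] ab bc xy by auto
  ultimately have ac: "adj a c" using xy(3) adj_sym bc(2) by blast
  have "{x, y} \<subseteq> {a, b, c}" if "x \<in> W" "y \<in> W" "adj x y" for x y
    using meet[of a b x y] meet[of b c x y] meet[of a c x y] ab bc ac that
      \<open>a \<noteq> b\<close> \<open>b \<noteq> c\<close> by auto
  then show ?thesis using ab bc ac unfolding one_triangle_def by blast
qed simp

text \<open>The two edges cover four vertices, as many as \<open>R\<close> has, so the uncovered
  part of \<open>R\<close> is exactly as large as the set of partners that lose their mates. Since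
  all four vertices lie in a transversal, none of these partners is itself covered.\<close>

lemma no_pm_disjoint_edges:
  assumes S: "closed S" and R: "R \<inter> S = {}" "card R = 4" and no: "\<not> pm (R \<union> S)"
    and W: "transversal W" "W \<subseteq> R \<union> S"
    and in_W: "a \<in> W" "b \<in> W" "c \<in> W" "d \<in> W"
    and e: "adj a b" "adj c d" "{a, b} \<inter> {c, d} = {}"
    and adj: "\<And>r y. r \<in> R - {a, b, c, d} \<Longrightarrow> y \<in> {a, b, c, d} - R \<Longrightarrow> adj r (mt y)"
  shows False
proof -
  have "pm (R \<union> S)"
  proof (rule pm_switch[OF S, where Q = "{a, b, c, d}"])
    show "finite R" using R(2) card.infinite by fastforce
    have "pm ({a, b} \<union> {c, d})" using e by (intro pm_Un[OF pm_pair pm_pair]) simp_all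
    moreover have "{a, b} \<union> {c, d} = {a, b, c, d}" by blast
    ultimately show "pm {a, b, c, d}" by simp
    have "a \<noteq> b" "c \<noteq> d" using e(1,2)[THEN adj_D(3)] by simp_all
    then show "card {a, b, c, d} = card R" using e(3) R(2) by (auto simp: card_insert_if)
    show "{a, b, c, d} \<subseteq> R \<union> S" using in_W W(2) by blast
    have Q: "{a, b, c, d} \<subseteq> W" using in_W by simp
    have "mt ` ({a, b, c, d} - R) \<subseteq> mt ` W" by (intro image_mono order_trans[OF Diff_subset Q])
    then have "{a, b, c, d} \<inter> mt ` ({a, b, c, d} - R) \<subseteq> W \<inter> mt ` W"
      by (rule Int_mono[OF Q])
    moreover have "W \<inter> mt ` W = {}" using W(1) unfolding transversal_def by blast
    ultimately show "{a, b, c, d} \<inter> mt ` ({a, b, c, d} - R) = {}" by (simp only: subset_empty)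
  qed (use R adj in simp_all)
  then show False using no by simp
qed

lemma transversal_Un:
  assumes "S = V - R - mt ` R" "R \<subseteq> V" "R \<inter> mt ` R = {}"
    and "N \<subseteq> S" "\<And>z. z \<in> S \<Longrightarrow> z \<in> N \<longleftrightarrow> mt z \<notin> N"
  shows "transversal (R \<union> N)"
  unfolding transversal_def
proof (intro conjI ballI)
  show "R \<union> N \<subseteq> V" using assms by blast
  fix x assume x: "x \<in> V"
  have mtR: "mt x \<in> R \<longleftrightarrow> x \<in> mt ` R" using mt_mt[OF x] mt_mt assms(2) by (metis image_iff subsetD)
  have mtR': "mt x \<in> mt ` R \<longleftrightarrow> x \<in> R" using mt_inj x assms(2) by (metis image_iff subsetD)
  have "mt x \<in> V" using x by (rule mt_in)
  then show "x \<in> R \<union> N \<longleftrightarrow> mt x \<notin> R \<union> N"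
    using mtR mtR' x assms(1,3,4) assms(5)[of x] by blast
qed

lemma closed_Diff_mt:
  assumes "S = V - R - mt ` R" "R \<subseteq> V"
  shows "closed S"
  unfolding closed_def
proof (intro conjI ballI)
  show "S \<subseteq> V" using assms(1) by blast
  fix x assume "x \<in> S"
  then have x: "x \<in> V" "x \<notin> R" "x \<notin> mt ` R" using assms(1) by auto
  have "mt x \<notin> R" using x mt_mt by (metis image_eqI)
  moreover have "mt x \<notin> mt ` R" using x mt_inj assms(2) by (metis image_iff subsetD)
  ultimately show "mt x \<in> S" using x mt_in assms(1) by simp
qed

text \<open>From here to \<open>no_pm_four\<close>, the set \<open>R\<close> consists of the partners of the endpoints of two
  disjoint edges, and \<open>R \<union> S\<close> is what remains after deleting these endpoints.\<close>

lemma no_pm_four_adjacent: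
  assumes S: "S = V - R - mt ` R" and R: "R = {p, q, r, s}" "card R = 4" "R \<subseteq> V" "R \<inter> mt ` R = {}"
    and no: "\<not> pm (R \<union> S)" and pq: "adj p q"
  shows "\<exists>W. transversal W \<and> R \<subseteq> W \<and> ((\<exists>t\<in>W. indep (W - {t})) \<or> one_triangle W)"
proof -
  have cS: "closed S" using S R(3) by (rule closed_Diff_mt)
  have dist: "distinct [p, q, r, s]" using R(1,2) by (intro card_distinct) simp
  have RS: "R \<inter> S = {}" using S by blast
  have bad: "\<not> pm ({r, s} \<union> S)"
  proof
    assume "pm ({r, s} \<union> S)"
    then have "pm ({p, q} \<union> ({r, s} \<union> S))"
      using dist RS R(1) by (intro pm_Un[OF pm_pair[OF pq]]) auto
    moreover have "{p, q} \<union> ({r, s} \<union> S) = R \<union> S" using R(1) by blast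
    ultimately show False using no by simp
  qed
  have rs: "r \<in> V" "s \<in> V" "r \<notin> S" "s \<notin> S" "r \<noteq> s" using R RS dist by auto
  note two = no_pm_two[OF cS rs bad]
  define N where "N = {z \<in> S. \<not> adj r z}"
  have ind: "indep ({r, s} \<union> N)" using two(3) by (simp add: N_def)
  have mtS: "mt z \<in> S" if "z \<in> S" for z using that cS by (simp add: closed_def)
  have N: "adj r (mt y)" "adj s (mt y)" if "y \<in> N" for y
    using that two(1)[of y] two(2)[of "mt y"] mtS by (auto simp: N_def)
  have W: "transversal (R \<union> N)"
    using two(1) mtS by (intro transversal_Un[OF S R(3,4)]) (auto simp: N_def)
  \<comment> \<open>As \<open>{r, s} \<union> N\<close> is independent, two disjoint edges in
    \<open>R \<union> N\<close> must use \<open>p\<close> and \<open>q\<close> between them. Only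
    \<open>r\<close> and \<open>s\<close> can then remain uncovered, and these see every partner of
    a vertex of \<open>N\<close>.\<close>
  have touch: "p \<in> {x, y} \<or> q \<in> {x, y}" if "x \<in> R \<union> N" "y \<in> R \<union> N" "adj x y" for x y
    using ind that R(1) unfolding indep_def by blast
  have "(\<exists>t\<in>R \<union> N. indep (R \<union> N - {t})) \<or> one_triangle (R \<union> N)"
  proof (rule star_or_triangle)
    fix x y u v
    assume *: "x \<in> R \<union> N" "y \<in> R \<union> N" "u \<in> R \<union> N" "v \<in> R \<union> N" "adj x y" "adj u v"
    show "{x, y} \<inter> {u, v} \<noteq> {}"
    proof
      assume disj: "{x, y} \<inter> {u, v} = {}"
      then have "p \<in> {x, y, u, v}" "q \<in> {x, y, u, v}"
      proof -
        have t1: "p \<in> {x, y} \<or> q \<in> {x, y}" and t2: "p \<in> {u, v} \<or> q \<in> {u, v}"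
          using touch * by blast+
        have "\<not> ({x, y} = {p, q} \<and> (p \<in> {u, v} \<or> q \<in> {u, v}))" using disj by blast
        then show "p \<in> {x, y, u, v}" "q \<in> {x, y, u, v}"
          using t1 t2 disj by blast+
      qed
      then have "adj r' (mt y')" if "r' \<in> R - {x, y, u, v}" "y' \<in> {x, y, u, v} - R" for r' y'
        using that R(1) N * by blast
      then show False
        using no_pm_disjoint_edges[OF cS RS R(2) no W _ *(1-6) disj] by (auto simp: N_def)
    qed
  qed (simp add: R(1))
  then show ?thesis using W by blast
qed

text \<open>Without disagreements the edges inside \<open>R \<union> N\<close> need no individual
  control: whichever vertices of \<open>R\<close> two disjoint edges leave uncovered, they see all
  partners of \<open>N\<close>.\<close>

lemma no_pm_four_uniform:
  assumes S: "S = V - R - mt ` R" and R: "card R = 4" "R \<subseteq> V" "R \<inter> mt ` R = {}"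
    and no: "\<not> pm (R \<union> S)"
    and uni: "\<And>p q z. p \<in> R \<Longrightarrow> q \<in> R \<Longrightarrow> p \<noteq> q \<Longrightarrow> z \<in> S \<Longrightarrow> adj p z \<Longrightarrow> \<not> adj q (mt z)"
  shows "\<exists>W. transversal W \<and> R \<subseteq> W \<and> ((\<exists>t\<in>W. indep (W - {t})) \<or> one_triangle W)"
proof -
  have cS: "closed S" using S R(2) by (rule closed_Diff_mt)
  have RS: "R \<inter> S = {}" using S by blast
  have mtS: "mt z \<in> S" "mt (mt z) = z" if "z \<in> S" for z
    using that cS mt_mt by (auto simp: closed_def)
  have or: "adj r z \<or> adj r (mt z)" if "z \<in> S" "r \<in> R" for r z
    using adj_or[OF cS that(1)] that R(2) RS by blast
  obtain p where p: "p \<in> R" using R(1) by (metis card.empty all_not_in_conv zero_neq_numeral)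
  obtain q where q: "q \<in> R" "q \<noteq> p"
  proof -
    have "card (R - {p}) = 3" using p R(1) by simp
    then have "R - {p} \<noteq> {}" by force
    then show ?thesis using that by blast
  qed
  \<comment> \<open>If \<open>p\<close> saw both ends, then whichever end \<open>q\<close> sees
    would disagree with the opposite end seen by \<open>p\<close>.\<close>
  have p1: "adj p z \<longleftrightarrow> \<not> adj p (mt z)" if "z \<in> S" for z
    using or[OF that p] or[OF that q(1)] uni[OF p q(1) q(2)[symmetric]] that mtS[OF that] by metis
  define N where "N = {z \<in> S. \<not> adj p z}"
  have N: "adj r (mt y)" if "y \<in> N" "r \<in> R" for y r
    using that p1[of y] or[of y r] uni[OF that(2) p, of y] by (auto simp: N_def)
  have W: "transversal (R \<union> N)"
    using p1 mtS(1) by (intro transversal_Un[OF S R(2,3)]) (auto simp: N_def)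
  have "(\<exists>t\<in>R \<union> N. indep (R \<union> N - {t})) \<or> one_triangle (R \<union> N)"
  proof (rule star_or_triangle)
    fix x y u v
    assume *: "x \<in> R \<union> N" "y \<in> R \<union> N" "u \<in> R \<union> N" "v \<in> R \<union> N" "adj x y" "adj u v"
    show "{x, y} \<inter> {u, v} \<noteq> {}"
    proof
      assume disj: "{x, y} \<inter> {u, v} = {}"
      have "adj r' (mt y')" if "r' \<in> R - {x, y, u, v}" "y' \<in> {x, y, u, v} - R" for r' y'
        using that N * by blast
      then show False
        using no_pm_disjoint_edges[OF cS RS R(1) no W _ * disj] by (auto simp: N_def)
    qed
  qed (use p in blast)
  then show ?thesis using W by blast
qed

text \<open>A disagreement at \<open>z\<close> uses up \<open>p\<close>, \<open>q\<close> and one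
  whole pair. Read contrapositively, the absence of a perfect matching passes to \<open>r\<close>
  and \<open>s\<close> over the smaller closed set, where \<open>no_pm_two\<close> applies.\<close>

lemma pm_cross:
  assumes S: "closed S" "{p, q, r, s} \<inter> S = {}" "distinct [p, q, r, s]"
    and z: "z \<in> S" "adj p z" "adj q (mt z)"
    and pm: "pm ({r, s} \<union> (S - {z, mt z}))"
  shows "pm ({p, q, r, s} \<union> S)"
proof -
  have zV: "z \<in> V" "mt z \<in> S" using S z by (auto simp: closed_def)
  have "mt z \<noteq> z" using zV(1) by (rule mt_neq)
  then have "pm ({p, z} \<union> {q, mt z})"
    using z(1) zV(2) S(2,3) by (intro pm_Un pm_pair z(2,3)) auto
  then have "pm (({p, z} \<union> {q, mt z}) \<union> ({r, s} \<union> (S - {z, mt z})))"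
    using pm by (rule pm_Un) (use z(1) zV(2) S(2,3) in auto)
  moreover have "({p, z} \<union> {q, mt z}) \<union> ({r, s} \<union> (S - {z, mt z})) = {p, q, r, s} \<union> S"
    using z(1) zV(2) by blast
  ultimately show ?thesis by simp
qed

text \<open>The vertex \<open>l\<close> produces further disagreements of \<open>p\<close>, with
  \<open>r\<close> and with \<open>s\<close>. Alternating between the closed sets \<open>S1\<close>
  and \<open>S2\<close>, which miss different pairs, shows that \<open>q\<close>, \<open>r\<close>
  and \<open>s\<close> agree on all of \<open>S\<close>; \<open>p\<close> is the only
  dissenter.\<close>

lemma no_pm_four_cross_aux:
  assumes S: "S = V - R - mt ` R" and R: "R = {p, q, r, s}" "card R = 4" "R \<subseteq> V" "R \<inter> mt ` R = {}"
    and no: "\<not> pm (R \<union> S)"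
    and z: "z \<in> S" "adj p z" "adj q (mt z)"
    and l: "l \<in> S - {z, mt z}" "\<not> adj r l" "adj p l"
  shows "\<exists>W. transversal W \<and> R \<subseteq> W \<and> ((\<exists>t\<in>W. indep (W - {t})) \<or> one_triangle W)"
proof -
  have cS: "closed S" using S R(3) by (rule closed_Diff_mt)
  have dist: "distinct [p, q, r, s]" using R(1,2) by (intro card_distinct) simp
  have RS: "R \<inter> S = {}" using S by blast
  have mtS: "mt x \<in> S" "mt (mt x) = x" "x \<in> V" if "x \<in> S" for x
    using that cS mt_mt by (auto simp: closed_def)
  have bad: "\<not> pm ({c, d} \<union> (S - {y, mt y}))"
    if "y \<in> S" "adj a y" "adj b (mt y)" "R = {a, b, c, d}" for a b c d y
  proof
    assume "pm ({c, d} \<union> (S - {y, mt y}))"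
    moreover have "distinct [a, b, c, d]" using that(4) R(2) by (intro card_distinct) simp
    ultimately have "pm (R \<union> S)"
      using pm_cross[OF cS, of a b c d y] that RS by simp
    then show False using no by simp
  qed
  define S1 where "S1 = S - {z, mt z}"
  define S2 where "S2 = S - {l, mt l}"
  have lS: "l \<in> S" "l \<noteq> z" "l \<noteq> mt z" using l by auto
  then have ml: "mt l \<in> S1" "l \<in> S1" "z \<in> S2" "mt z \<in> S2"
    using z mtS[OF lS(1)] mtS[OF z(1)] by (auto simp: S1_def S2_def)
  have cS1: "closed S1" and cS2: "closed S2"
    unfolding S1_def S2_def using closed_diff_pair[OF cS] mtS z(1) lS(1) by blast+
  have v: "p \<in> V" "q \<in> V" "r \<in> V" "s \<in> V" using R by auto
  have n1: "p \<notin> S1" "q \<notin> S1" "r \<notin> S1" "s \<notin> S1" using RS R(1) by (auto simp: S1_def)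
  have n2: "p \<notin> S2" "q \<notin> S2" "r \<notin> S2" "s \<notin> S2" using RS R(1) by (auto simp: S2_def)
  have d: "r \<noteq> s" "q \<noteq> s" "q \<noteq> r" using dist by auto
  have b1: "\<not> pm ({r, s} \<union> S1)" unfolding S1_def using bad[of z p q] z R(1) by blast
  note t1 = no_pm_two[OF cS1 v(3,4) n1(3,4) d(1) b1]
  \<comment> \<open>Since \<open>p\<close> sees \<open>l\<close>, this gives two disagreements at
    the pair of \<open>l\<close>, one with \<open>r\<close> and one with \<open>s\<close>.\<close>
  have rl: "adj r (mt l)" "adj s (mt l)" using t1(1)[OF ml(2)] t1(2)[OF ml(1)] l(2) by auto
  have b2: "\<not> pm ({q, s} \<union> S2)" unfolding S2_def
    using bad[of l p r q s] lS l rl R(1) by (simp add: insert_commute)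
  note t2 = no_pm_two[OF cS2 v(2,4) n2(2,4) d(2) b2]
  have b3: "\<not> pm ({q, r} \<union> S2)" unfolding S2_def
    using bad[of l p s q r] lS l rl R(1) by (simp add: insert_commute)
  note t3 = no_pm_two[OF cS2 v(2,3) n2(2,3) d(3) b3]
  \<comment> \<open>The pair of \<open>z\<close> survives in \<open>S2\<close>, where
    \<open>q\<close> agrees with \<open>r\<close> and \<open>s\<close>. So both see
    \<open>mt z\<close>, and \<open>p\<close>, which sees \<open>z\<close>, disagrees with them
    there as well.\<close>
  have qz: "\<not> adj q z" "adj s (mt z)" "\<not> adj s z" "adj r (mt z)" "\<not> adj r z"
    using t2(1,2)[OF ml(3)] t2(2)[OF ml(4)] t3(2)[OF ml(3)] t3(2)[OF ml(4)] z(3) by auto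
  have b4: "\<not> pm ({q, r} \<union> S1)" unfolding S1_def
    using bad[of z p s q r] z qz R(1) by (simp add: insert_commute)
  note t4 = no_pm_two[OF cS1 v(2,3) n1(2,3) d(3) b4]
  have b5: "\<not> pm ({q, s} \<union> S1)" unfolding S1_def
    using bad[of z p r q s] z qz R(1) by (simp add: insert_commute)
  note t5 = no_pm_two[OF cS1 v(2,4) n1(2,4) d(2) b5]
  define L where "L = {y \<in> S1. \<not> adj q y}"
  \<comment> \<open>The pair of \<open>z\<close> is missing from \<open>S1\<close>, so its
    representative is added by hand: \<open>z\<close> is the end that none of \<open>q\<close>,
    \<open>r\<close>, \<open>s\<close> sees.\<close>
  define N where "N = insert z L"
  have mtS1: "mt y \<in> S1" if "y \<in> S1" for y using that cS1 by (simp add: closed_def)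
  have L: "adj q (mt y)" "adj r (mt y)" "adj s (mt y)" if "y \<in> L" for y
    using that t4(1)[of y] t4(2)[of "mt y"] t5(2)[of "mt y"] mtS1 by (auto simp: L_def)
  have N: "adj r' (mt y)" if "y \<in> N" "r' \<in> {q, r, s}" for y r'
    using that L z(3) qz by (auto simp: N_def)
  have i1: "indep ({q, r} \<union> L)" "indep ({q, s} \<union> L)" "indep ({r, s} \<union> L)"
  proof -
    have "{y \<in> S1. \<not> adj r y} = L" using t4(2) unfolding L_def by blast
    then show "indep ({q, r} \<union> L)" "indep ({q, s} \<union> L)" "indep ({r, s} \<union> L)"
      using t4(3) t5(3) t1(3) unfolding L_def by simp_all
  qed
  have i2: "indep ({q, s} \<union> {y \<in> S2. \<not> adj q y})" using t2(3) .
  have L2: "y \<in> S2" if "y \<in> L" "y \<noteq> l" for y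
  proof -
    have "mt l \<notin> L" using t4(1)[OF ml(2)] t4(2)[OF ml(2)] l(2) by (auto simp: L_def)
    then show ?thesis using that by (auto simp: L_def S2_def S1_def)
  qed
  \<comment> \<open>\<open>z\<close> is compared with \<open>L\<close> inside \<open>S2\<close>,
    which lacks the pair of \<open>l\<close>; whether \<open>z\<close> and \<open>l\<close> are
    adjacent stays open.\<close>
  have zL: "\<not> adj z y" if "y \<in> L" "y \<noteq> l" for y
    using i2 ml(3) qz(1) L2[OF that] that unfolding indep_def L_def by blast
  have zq: "\<not> adj z q" "\<not> adj z r" "\<not> adj z s" "\<not> adj z z"
    using qz adj_sym adj_D(3) by blast+
  have NS: "N \<subseteq> S" using z by (auto simp: N_def L_def S1_def)
  have zN: "mt z \<notin> N" using mt_neq mtS(3)[OF z(1)] by (auto simp: N_def L_def S1_def)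
  have W: "transversal (R \<union> N)"
  proof (rule transversal_Un[OF S R(3,4) NS])
    fix x assume x: "x \<in> S"
    consider "x = z" | "x = mt z" | "x \<in> S1" using x by (auto simp: S1_def)
    then show "x \<in> N \<longleftrightarrow> mt x \<notin> N"
    proof cases
      case 1
      then show ?thesis using zN by (simp add: N_def)
    next
      case 2
      then show ?thesis using zN mtS(2)[OF z(1)] by (simp add: N_def)
    next
      case 3
      moreover have "x \<noteq> z" "mt x \<noteq> z" using 3 mtS1[OF 3] by (auto simp: S1_def)
      ultimately show ?thesis using t4(1)[OF 3] mtS1[OF 3] by (simp add: N_def L_def)
    qed
  qed
  \<comment> \<open>Of two disjoint edges at most one is \<open>{z, l}\<close>, so the other covers
    \<open>p\<close>. The uncovered vertices of \<open>R\<close> are then among \<open>q\<close>,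
    \<open>r\<close>, \<open>s\<close>, all of which see the partners of \<open>N\<close>.\<close>
  have touch: "p \<in> {x, y} \<or> {x, y} = {z, l}" if xyN: "x \<in> R \<union> N" "y \<in> R \<union> N" "adj x y" for x y
  proof (rule ccontr)
    assume neg: "\<not> (p \<in> {x, y} \<or> {x, y} = {z, l})"
    have xy: "x \<in> {q, r, s} \<union> L \<or> x = z" "y \<in> {q, r, s} \<union> L \<or> y = z"
      using that neg R(1) by (auto simp: N_def)
    have "\<not> adj a b" if "a \<in> {q, r, s} \<union> L" "b \<in> {q, r, s} \<union> L" for a b
      using that i1 unfolding indep_def by blast
    then have "x = z \<or> y = z" using xy that by blast
    then obtain w where w: "{x, y} = {z, w}" "adj z w" using adj_sym[OF xyN(3)] xyN(3) by auto
    then have "w \<in> {q, r, s} \<union> L \<or> w = z" using xy by (auto simp: doubleton_eq_iff)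
    then have "w = l" using w(2) zq zL by blast
    then show False using w neg by blast
  qed
  have "(\<exists>t\<in>R \<union> N. indep (R \<union> N - {t})) \<or> one_triangle (R \<union> N)"
  proof (rule star_or_triangle)
    fix x y u v
    assume *: "x \<in> R \<union> N" "y \<in> R \<union> N" "u \<in> R \<union> N" "v \<in> R \<union> N" "adj x y" "adj u v"
    show "{x, y} \<inter> {u, v} \<noteq> {}"
    proof
      assume disj: "{x, y} \<inter> {u, v} = {}"
      have "p \<in> {x, y} \<or> p \<in> {u, v}"
        using touch[OF *(1,2,5)] touch[OF *(3,4,6)] disj by (metis Int_absorb insert_not_empty)
      then have "adj r' (mt y')" if "r' \<in> R - {x, y, u, v}" "y' \<in> {x, y, u, v} - R" for r' y'
        using that N * R(1) by blast
      then show False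
        using no_pm_disjoint_edges[OF cS RS R(2) no W _ * disj] NS by blast
    qed
  qed (simp add: R(1))
  then show ?thesis using W by blast
qed

text \<open>If \<open>p\<close> or \<open>q\<close> sees some vertex of another pair that
  \<open>r\<close> does not see, the auxiliary lemma applies. Otherwise \<open>p\<close> and
  \<open>q\<close> see none of the ends missed by \<open>r\<close> and \<open>s\<close>, so these
  ends form an independent set together with \<open>R\<close>; only the representative
  \<open>z\<close> of the crossing pair has to be omitted.\<close>

lemma no_pm_four_cross:
  assumes S: "S = V - R - mt ` R" and R: "R = {p, q, r, s}" "card R = 4" "R \<subseteq> V" "R \<inter> mt ` R = {}"
    and no: "\<not> pm (R \<union> S)" and ind: "indep R"
    and z: "z \<in> S" "adj p z" "adj q (mt z)"
  shows "\<exists>W. transversal W \<and> R \<subseteq> W \<and> ((\<exists>t\<in>W. indep (W - {t})) \<or> one_triangle W)"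
proof (cases "\<exists>l\<in>S - {z, mt z}. \<not> adj r l \<and> (adj p l \<or> adj q l)")
  case True
  then obtain l where l: "l \<in> S - {z, mt z}" "\<not> adj r l" "adj p l \<or> adj q l" by blast
  have cS: "closed S" using S R(3) by (rule closed_Diff_mt)
  have mz: "mt z \<in> S" "mt (mt z) = z" using z(1) cS mt_mt by (auto simp: closed_def)
  show ?thesis
  proof (cases "adj p l")
    case True
    show ?thesis by (rule no_pm_four_cross_aux[OF S R no z l(1,2) True])
  next
    case False
    then have q: "adj q l" using l(3) by blast
    \<comment> \<open>Exchanging \<open>p\<close> with \<open>q\<close> turns the disagreement at
      \<open>z\<close> into one at \<open>mt z\<close>.\<close>
    have "R = {q, p, r, s}" using R(1) by (simp add: insert_commute)
    moreover have "l \<in> S - {mt z, mt (mt z)}" "adj p (mt (mt z))" using l(1) mz z(2) by auto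
    ultimately show ?thesis using no_pm_four_cross_aux[OF S _ R(2-4) no mz(1) z(3) _ _ l(2) q] by blast
  qed
next
  case False
  have cS: "closed S" using S R(3) by (rule closed_Diff_mt)
  have dist: "distinct [p, q, r, s]" using R(1,2) by (intro card_distinct) simp
  have RS: "R \<inter> S = {}" using S by blast
  have zV: "z \<in> V" "mt z \<in> S" "mt (mt z) = z" using z(1) cS mt_mt by (auto simp: closed_def)
  define S1 where "S1 = S - {z, mt z}"
  have cS1: "closed S1" unfolding S1_def using cS zV(1) by (rule closed_diff_pair)
  have b: "\<not> pm ({r, s} \<union> S1)"
    using pm_cross[OF cS _ dist z] no R(1) RS by (auto simp: S1_def)
  have rs: "r \<in> V" "s \<in> V" "r \<notin> S1" "s \<notin> S1" "r \<noteq> s" using R RS dist by (auto simp: S1_def)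
  note t = no_pm_two[OF cS1 rs b]
  define L where "L = {y \<in> S1. \<not> adj r y}"
  have mtS1: "mt y \<in> S1" if "y \<in> S1" for y using that cS1 by (simp add: closed_def)
  have LS: "insert z L \<subseteq> S" using z by (auto simp: L_def S1_def)
  have zN: "mt z \<notin> insert z L" using mt_neq zV(1) by (auto simp: L_def S1_def)
  have W: "transversal (R \<union> insert z L)"
  proof (rule transversal_Un[OF S R(3,4) LS])
    fix x assume x: "x \<in> S"
    consider "x = z" | "x = mt z" | "x \<in> S1" using x by (auto simp: S1_def)
    then show "x \<in> insert z L \<longleftrightarrow> mt x \<notin> insert z L"
    proof cases
      case 1
      then show ?thesis using zN by simp
    next
      case 2
      then show ?thesis using zN zV(3) by simp
    next
      case 3
      moreover have "x \<noteq> z" "mt x \<noteq> z" using 3 mtS1[OF 3] by (auto simp: S1_def)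
      ultimately show ?thesis using t(1)[OF 3] mtS1[OF 3] by (simp add: L_def)
    qed
  qed
  have pqL: "\<not> adj p y" "\<not> adj q y" if "y \<in> L" for y
    using that False by (auto simp: L_def S1_def)
  have "indep ({r, s} \<union> L)" using t(3) by (simp add: L_def)
  then have "indep (R \<union> L)"
    using ind pqL adj_sym R(1) unfolding indep_def by blast
  moreover have "R \<union> insert z L - {z} \<subseteq> R \<union> L" by blast
  ultimately have "indep (R \<union> insert z L - {z})" unfolding indep_def by blast
  then show ?thesis using W by blast
qed

lemma no_pm_four:
  assumes S: "S = V - R - mt ` R" and R: "card R = 4" "R \<subseteq> V" "R \<inter> mt ` R = {}"
    and no: "\<not> pm (R \<union> S)"
  shows "\<exists>W. transversal W \<and> R \<subseteq> W \<and> ((\<exists>t\<in>W. indep (W - {t})) \<or> one_triangle W)"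
proof -
  have four: "\<exists>r s. R = {p, q, r, s}" if "p \<in> R" "q \<in> R" "p \<noteq> q" for p q
  proof -
    have "card (R - {p, q}) = 2" using that R(1) by (subst card_Diff_subset) auto
    then obtain r s where "R - {p, q} = {r, s}" by (meson card_2_iff)
    then have "R = {p, q, r, s}" using that by blast
    then show ?thesis by blast
  qed
  show ?thesis
  proof (cases "indep R")
    case False
    then obtain p q where pq: "p \<in> R" "q \<in> R" "adj p q" unfolding indep_def by blast
    then have "p \<noteq> q" using adj_D by blast
    then obtain r s where "R = {p, q, r, s}" using four[OF pq(1,2)] by blast
    then show ?thesis using no_pm_four_adjacent[OF S _ R no pq(3)] by blast
  next
    case True
    show ?thesis
    proof (cases "\<exists>p\<in>R. \<exists>q\<in>R. \<exists>z\<in>S. p \<noteq> q \<and> adj p z \<and> adj q (mt z)")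
      case T: True
      then obtain p q z where pq: "p \<in> R" "q \<in> R" "p \<noteq> q" "z \<in> S" "adj p z" "adj q (mt z)" by blast
      then obtain r s where "R = {p, q, r, s}" using four[OF pq(1-3)] by blast
      then show ?thesis using no_pm_four_cross[OF S _ R no True pq(4-6)] by blast
    next
      case False
      then show ?thesis using no_pm_four_uniform[OF S R no] by blast
    qed
  qed
qed

end

section \<open>Perfect matchings, counting and forcing numbers\<close>

lemma perfect_matching_partner:
  assumes "simple_graph V E" and P: "perfect_matching V E P"
  shows "\<exists>f. (\<forall>x\<in>V. f x \<in> V \<and> f x \<noteq> x \<and> f (f x) = x \<and> {x, f x} \<in> P) \<and> P = (\<lambda>x. {x, f x}) ` V"
proof -
  have PE: "P \<subseteq> E" and UP: "\<Union>P = V"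
    and disj: "\<And>e e'. e \<in> P \<Longrightarrow> e' \<in> P \<Longrightarrow> e \<inter> e' \<noteq> {} \<Longrightarrow> e = e'"
    using P unfolding perfect_matching_def matching_def by blast+
  have pair: "\<exists>x y. x \<in> V \<and> y \<in> V \<and> x \<noteq> y \<and> e = {x, y}" if "e \<in> P" for e
    using that PE assms(1) unfolding simple_graph_def by blast
  have "\<exists>y. y \<in> V \<and> y \<noteq> x \<and> {x, y} \<in> P" if x: "x \<in> V" for x
  proof -
    obtain e where e: "e \<in> P" "x \<in> e" using x UP by blast
    obtain a b where "a \<in> V" "b \<in> V" "a \<noteq> b" "e = {a, b}" using pair[OF e(1)] by blast
    then show ?thesis using e by (cases "x = a") (auto simp: insert_commute)
  qed
  then obtain f where f: "f x \<in> V" "f x \<noteq> x" "{x, f x} \<in> P" if "x \<in> V" for x by metis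
  have uniq: "y = f x" if "x \<in> V" "{x, y} \<in> P" for x y
  proof -
    have "{x, y} = {x, f x}" using that f(3) by (intro disj) auto
    then show ?thesis by (auto simp: doubleton_eq_iff)
  qed
  have inv: "f (f x) = x" if "x \<in> V" for x
    using uniq[of "f x" x] f[OF that] by (simp add: insert_commute)
  have "P = (\<lambda>x. {x, f x}) ` V"
  proof
    show "(\<lambda>x. {x, f x}) ` V \<subseteq> P" using f(3) by blast
    show "P \<subseteq> (\<lambda>x. {x, f x}) ` V"
    proof
      fix e assume e: "e \<in> P"
      obtain a b where "a \<in> V" "e = {a, b}" using pair[OF e] by blast
      then show "e \<in> (\<lambda>x. {x, f x}) ` V" using uniq e by blast
    qed
  qed
  then show ?thesis using f inv by (intro exI[of _ f]) simp
qed

lemma finite_perfect_matching: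
  assumes "finite V" "perfect_matching V E P"
  shows "finite P"
  using assms by (intro finite_UnionD) (simp add: perfect_matching_def)

lemma card_perfect_matching:
  assumes "simple_graph V E" "perfect_matching V E P"
  shows "2 * card P = card V"
proof -
  have fV: "finite V" using assms(1) by (simp add: simple_graph_def)
  have PE: "P \<subseteq> E" and UP: "\<Union>P = V"
    and disj: "\<And>e e'. e \<in> P \<Longrightarrow> e' \<in> P \<Longrightarrow> e \<noteq> e' \<Longrightarrow> e \<inter> e' = {}"
    using assms(2) unfolding perfect_matching_def matching_def by blast+
  have "2 * card P = card (\<Union>P)"
  proof (rule card_partition)
    show "finite P" using finite_perfect_matching fV assms(2) by blast
    show "finite (\<Union>P)" using UP fV by simp
    show "card e = 2" if "e \<in> P" for e
    proof -
      have "e \<in> E" using that PE by blast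
      then obtain x y where "x \<noteq> y" "e = {x, y}" using assms(1) unfolding simple_graph_def by blast
      then show ?thesis by simp
    qed
  qed (rule disj)
  then show ?thesis using UP by simp
qed

text \<open>A Hall-type count: the partners under \<open>P\<close> of the vertices of
  \<open>A\<close> are distinct, lie in \<open>X\<close>, and avoid the vertices that
  \<open>N\<close> already occupies.\<close>

lemma card_le_by_matching:
  assumes "simple_graph V E" and P: "perfect_matching V E P"
    and N: "N \<subseteq> P" "\<Union>N \<subseteq> X" "\<Union>N \<inter> A = {}"
    and AX: "A \<subseteq> V" "X \<subseteq> V" "\<And>x y. x \<in> A \<Longrightarrow> {x, y} \<in> E \<Longrightarrow> y \<in> X"
  shows "card A + card (\<Union>N) \<le> card X"
proof -
  obtain f where "\<forall>x\<in>V. f x \<in> V \<and> f x \<noteq> x \<and> f (f x) = x \<and> {x, f x} \<in> P"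
    using perfect_matching_partner[OF assms(1,2)] by blast
  then have f: "\<And>x. x \<in> V \<Longrightarrow> f (f x) = x" "\<And>x. x \<in> V \<Longrightarrow> {x, f x} \<in> P" by simp_all
  have PE: "P \<subseteq> E" and disj: "\<And>e e'. e \<in> P \<Longrightarrow> e' \<in> P \<Longrightarrow> e \<inter> e' \<noteq> {} \<Longrightarrow> e = e'"
    using P unfolding perfect_matching_def matching_def by blast+
  have fX: "finite X" using assms(1) AX(2) finite_subset by (auto simp: simple_graph_def)
  have "f x \<in> X - \<Union>N" if x: "x \<in> A" for x
  proof
    have e: "{x, f x} \<in> P" using x AX(1) f(2) by blast
    then show "f x \<in> X" using PE AX(3) x by blast
    show "f x \<notin> \<Union>N"
    proof
      assume "f x \<in> \<Union>N"
      then obtain e' where e': "e' \<in> N" "f x \<in> e'" by blast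
      have "{x, f x} = e'" using e e' N(1) by (intro disj) auto
      then show False using e'(1) N(3) x by blast
    qed
  qed
  moreover have "inj_on f A" using f(1) AX(1) by (metis inj_onI subsetD)
  ultimately have "card A \<le> card (X - \<Union>N)" using fX by (intro card_inj_on_le) auto
  moreover have "card (X - \<Union>N) = card X - card (\<Union>N)" "card (\<Union>N) \<le> card X"
    using N(2) fX by (auto intro: card_Diff_subset card_mono finite_subset)
  ultimately show ?thesis by simp
qed

lemma perfect_matching_subset_eq:
  assumes "perfect_matching V E P" "perfect_matching V E P'" "P \<subseteq> P'" "simple_graph V E"
  shows "P' = P"
proof
  show "P' \<subseteq> P"
  proof
    fix e assume e: "e \<in> P'"
    then have "e \<in> E" using assms(2) unfolding perfect_matching_def matching_def by blast
    then obtain x y where "e = {x, y}" "x \<in> V" using assms(4) unfolding simple_graph_def by blast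
    moreover from this obtain e' where e': "e' \<in> P" "x \<in> e'"
      using assms(1) unfolding perfect_matching_def by blast
    ultimately have "e \<inter> e' \<noteq> {}" "e' \<in> P'" using assms(3) by auto
    then have "e = e'"
      using assms(2) e unfolding perfect_matching_def matching_def by metis
    then show "e \<in> P" using e' by simp
  qed
qed fact

text \<open>Without the matching edges at \<open>x\<close> and \<open>y\<close>, only
  \<open>n - 2\<close> edges remain, too few to force. A second perfect matching containing them can
  differ only on the four endpoints, and a change there closes an alternating 4-cycle.\<close>

lemma square_if_forcing_number:
  assumes G: "simple_graph V E" and P: "perfect_matching V E P"
    and n: "card V = 2 * n" "forcing_number V E P = n - 1"
    and f: "\<And>x. x \<in> V \<Longrightarrow> f x \<in> V" "\<And>x. x \<in> V \<Longrightarrow> f x \<noteq> x"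
      "\<And>x. x \<in> V \<Longrightarrow> f (f x) = x" "\<And>x. x \<in> V \<Longrightarrow> {x, f x} \<in> P"
    and xy: "x \<in> V" "y \<in> V" "y \<noteq> x" "y \<noteq> f x"
  shows "{x, y} \<in> E \<and> {f x, f y} \<in> E \<or> {x, f y} \<in> E \<and> {f x, y} \<in> E"
proof -
  have fV: "finite V" using G by (simp add: simple_graph_def)
  have fP: "finite P" by (rule finite_perfect_matching[OF fV P])
  have cP: "card P = n" using card_perfect_matching[OF G P] n(1) by simp
  have PE: "P \<subseteq> E" and UP: "\<Union>P = V"
    and disj: "\<And>e e'. e \<in> P \<Longrightarrow> e' \<in> P \<Longrightarrow> e \<inter> e' \<noteq> {} \<Longrightarrow> e = e'"
    using P unfolding perfect_matching_def matching_def by blast+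
  let ?e1 = "{x, f x}" and ?e2 = "{y, f y}"
  have e12: "?e1 \<in> P" "?e2 \<in> P" using f(4) xy by blast+
  have ne: "f y \<noteq> x" "f y \<noteq> f x" using f(3) xy by metis+
  then have "?e1 \<noteq> ?e2" using xy by (auto simp: doubleton_eq_iff)
  define S where "S = P - {?e1, ?e2}"
  have "card {?e1, ?e2} = 2" using \<open>?e1 \<noteq> ?e2\<close> by simp
  \<comment> \<open>With truncated subtraction \<open>n - 1 \<le> n - 2\<close> would hold for
    \<open>n \<le> 1\<close>, so the bound on \<open>n\<close> is kept for the contradiction
    below.\<close>
  then have cS: "card S = n - 2" "n \<ge> 2"
    using e12 cP fP card_mono[OF fP, of "{?e1, ?e2}"]
    by (auto simp: S_def card_Diff_subset)
  have "\<not> forcing_set V E P S"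
  proof
    assume "forcing_set V E P S"
    then have "card S \<in> {card S | S. forcing_set V E P S}" by blast
    moreover have "{card S | S. forcing_set V E P S} \<subseteq> card ` Pow P"
      unfolding forcing_set_def by blast
    then have "finite {card S | S. forcing_set V E P S}"
      using fP by (meson finite_Pow_iff finite_imageI finite_subset)
    ultimately have "Min {card S | S. forcing_set V E P S} \<le> card S" by (intro Min_le)
    then have "n - 1 \<le> card S" using n(2) by (simp add: forcing_number_def)
    then show False using cS by simp
  qed
  then obtain P' where P': "perfect_matching V E P'" "S \<subseteq> P'" "P' \<noteq> P"
    unfolding forcing_set_def S_def by blast
  have P'E: "P' \<subseteq> E" and disj': "\<And>e e'. e \<in> P' \<Longrightarrow> e' \<in> P' \<Longrightarrow> e \<inter> e' \<noteq> {} \<Longrightarrow> e = e'"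
    using P'(1) unfolding perfect_matching_def matching_def by blast+
  obtain g where "\<forall>x\<in>V. g x \<in> V \<and> g x \<noteq> x \<and> g (g x) = x \<and> {x, g x} \<in> P'"
    using perfect_matching_partner[OF G P'(1)] by blast
  then have g: "\<And>x. x \<in> V \<Longrightarrow> g x \<in> V" "\<And>x. x \<in> V \<Longrightarrow> g x \<noteq> x"
    "\<And>x. x \<in> V \<Longrightarrow> g (g x) = x" "\<And>x. x \<in> V \<Longrightarrow> {x, g x} \<in> P'" by simp_all
  \<comment> \<open>Every vertex other than the four endpoints is covered in \<open>P'\<close> by an
    edge of \<open>S\<close>, so it cannot be paired with one of them.\<close>
  have g4: "g z \<in> {x, f x, y, f y}" if z: "z \<in> {x, f x, y, f y}" for z
  proof (rule ccontr)
    assume nz: "g z \<notin> {x, f x, y, f y}"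
    have zV: "z \<in> V" using z xy f(1) by blast
    have "g z \<in> \<Union>P" using g(1)[OF zV] UP by simp
    then obtain e where e: "e \<in> P" "g z \<in> e" by blast
    then have "e \<in> S" using nz by (auto simp: S_def)
    then have "e = {z, g z}" using e(2) P'(2) g(4)[OF zV] by (intro disj') auto
    then have "z \<in> e" by simp
    then have "e = ?e1 \<or> e = ?e2" using z disj[OF e(1) e12(1)] disj[OF e(1) e12(2)] by blast
    then show False using nz e(2) by blast
  qed
  have V4: "f x \<in> V" "f y \<in> V" using f(1) xy by blast+
  have "g x \<noteq> x" by (rule g(2)[OF xy(1)])
  then consider "g x = f x" | "g x = y" | "g x = f y" using g4[of x] by blast
  then show ?thesis
  proof cases
    case 1
    then have "g (f x) = x" using g(3) xy by metis
    then have "g y \<noteq> x" "g y \<noteq> f x" using 1 g(3) xy by metis+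
    then have "g y = f y" using g4[of y] g(2)[OF xy(2)] by blast
    then have "?e1 \<in> P'" "?e2 \<in> P'" using g(4)[OF xy(1)] g(4)[OF xy(2)] 1 by simp_all
    then have "P \<subseteq> P'" using P'(2) by (auto simp: S_def)
    then have "P' = P" by (rule perfect_matching_subset_eq[OF P P'(1) _ G])
    then show ?thesis using P'(3) by simp
  next
    case 2
    have "g y = x" using 2 g(3)[OF xy(1)] by simp
    then have "g (f x) \<noteq> x" "g (f x) \<noteq> y" using 2 g(3)[OF V4(1)] xy f(2)[OF xy(1)] by auto
    then have "g (f x) = f y" using g4[of "f x"] g(2)[OF V4(1)] by blast
    then show ?thesis using g(4)[OF xy(1)] g(4)[OF V4(1)] 2 P'E by auto
  next
    case 3
    have "g (f y) = x" using 3 g(3)[OF xy(1)] by simp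
    then have "g (f x) \<noteq> x" "g (f x) \<noteq> f y" using 3 g(3)[OF V4(1)] ne f(2)[OF xy(1)] by auto
    then have "g (f x) = y" using g4[of "f x"] g(2)[OF V4(1)] by blast
    then show ?thesis using g(4)[OF xy(1)] g(4)[OF V4(1)] 3 P'E by auto
  qed
qed

text \<open>\<open>Max\<close> is attained on a finite nonempty set; finiteness holds because every
  perfect matching is a set of subsets of \<open>V\<close>.\<close>

lemma max_forcing_number_attained:
  assumes "simple_graph V E" "has_perfect_matching V E"
  obtains P where "perfect_matching V E P" "forcing_number V E P = max_forcing_number V E"
proof -
  let ?A = "{forcing_number V E M | M. perfect_matching V E M}"
  have "?A \<subseteq> forcing_number V E ` Pow (Pow V)" unfolding perfect_matching_def by blast
  moreover have "finite V" using assms(1) by (simp add: simple_graph_def)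
  ultimately have "finite ?A" by (meson finite_Pow_iff finite_imageI finite_subset)
  moreover have "?A \<noteq> {}" using assms(2) unfolding has_perfect_matching_def by blast
  ultimately have "Max ?A \<in> ?A" by (rule Max_in)
  then obtain P where "perfect_matching V E P" "Max ?A = forcing_number V E P" by auto
  then show thesis using that[of P] by (simp add: max_forcing_number_def)
qed

lemma square_matching_partner:
  assumes G: "simple_graph V E" and P: "perfect_matching V E P"
    and n: "card V = 2 * n" "forcing_number V E P = n - 1"
  obtains mt where "square_matching V E mt" "P = (\<lambda>x. {x, mt x}) ` V"
proof -
  obtain f where "\<forall>x\<in>V. f x \<in> V \<and> f x \<noteq> x \<and> f (f x) = x \<and> {x, f x} \<in> P"
    and fP: "P = (\<lambda>x. {x, f x}) ` V"
    using perfect_matching_partner[OF G P] by blast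
  then have f: "\<And>x. x \<in> V \<Longrightarrow> f x \<in> V" "\<And>x. x \<in> V \<Longrightarrow> f x \<noteq> x"
    "\<And>x. x \<in> V \<Longrightarrow> f (f x) = x" "\<And>x. x \<in> V \<Longrightarrow> {x, f x} \<in> P" by simp_all
  have "P \<subseteq> E" using P unfolding perfect_matching_def matching_def by blast
  then have "square_matching V E f"
    using G f square_if_forcing_number[OF G P n f] by unfold_locales auto
  then show thesis using that fP by blast
qed

section \<open>Edges and pairs of edges that do not extend\<close>

context square_matching
begin

text \<open>For \<open>y\<close> other than \<open>x\<close> and \<open>mt x\<close>, the 4-cycle
  contains the edge from \<open>x\<close> to \<open>y\<close>, or the edge from \<open>x\<close> to
  \<open>mt y\<close>, followed by the matching edge at \<open>y\<close>. This supplies the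
  connectedness that extendability demands.\<close>

lemma connected: "connected_graph V E"
  unfolding connected_graph_def
proof (intro ballI)
  fix x y assume xy: "x \<in> V" "y \<in> V"
  let ?r = "(\<lambda>a b. {a, b} \<in> E)\<^sup>*\<^sup>*"
  have "{mt y, y} \<in> E" "{x, mt x} \<in> E" using mt_edge xy by (auto simp: insert_commute)
  then show "?r x y"
    using square[OF xy] by (cases "y = x"; cases "y = mt x")
      (auto intro: r_into_rtranclp converse_rtranclp_into_rtranclp)
qed

lemma extend_matching:
  assumes "matching E N" "\<Union>N \<subseteq> V" "pm (V - \<Union>N)"
  shows "\<exists>P. perfect_matching V E P \<and> N \<subseteq> P"
proof -
  obtain Q where "perfect_matching (V - \<Union>N) E Q"
    using assms(3) by (auto simp: pm_def has_perfect_matching_def)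
  moreover have "perfect_matching (\<Union>N) E N" using assms(1) by (simp add: perfect_matching_def)
  ultimately have "perfect_matching (\<Union>N \<union> (V - \<Union>N)) E (N \<union> Q)"
    by (intro perfect_matching_Un) auto
  moreover have "\<Union>N \<union> (V - \<Union>N) = V" using assms(2) by blast
  ultimately show ?thesis by auto
qed

lemma mt_transversal:
  assumes "transversal W" shows "mt ` W = V - W"
proof
  show "mt ` W \<subseteq> V - W" using assms mt_in unfolding transversal_def by blast
  show "V - W \<subseteq> mt ` W"
  proof
    fix x assume x: "x \<in> V - W"
    then have "mt x \<in> W" using assms unfolding transversal_def by blast
    moreover have "x = mt (mt x)" using x mt_mt by simp
    ultimately show "x \<in> mt ` W" by blast
  qed
qed

lemma card_transversal:
  assumes "transversal W" shows "card V = 2 * card W" "card (V - W) = card W"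
proof -
  have WV: "W \<subseteq> V" using assms by (simp add: transversal_def)
  then show 1: "card (V - W) = card W"
    using mt_transversal[OF assms] inj_on_mt by (metis card_image)
  have "card (V - W) = card V - card W" "card W \<le> card V"
    using WV finite_V by (auto intro: card_Diff_subset card_mono finite_subset)
  then show "card V = 2 * card W" using 1 by simp
qed

text \<open>Used contrapositively: excluding independent transversals proves
  \<open>1\<close>-extendability.\<close>

lemma nonextendable_edge:
  assumes xy: "adj x y" and no: "\<not> (\<exists>P. perfect_matching V E P \<and> {{x, y}} \<subseteq> P)"
  shows "\<exists>I. transversal I \<and> indep I"
proof -
  have V: "x \<in> V" "y \<in> V" "x \<noteq> y" using adj_D[OF xy] by blast+
  have npm: "\<not> pm (V - {x, y})"
    using extend_matching[of "{{x, y}}"] no V xy by (auto simp: matching_def adj_def)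
  have "closed V" using mt_in by (simp add: closed_def)
  have "y \<noteq> mt x"
    using pm_closed[OF closed_diff_pair[OF \<open>closed V\<close> V(1)]] npm by blast
  define R where "R = {mt x, mt y}"
  define S where "S = V - R - mt ` R"
  have mtR: "mt ` R = {x, y}" using V mt_mt by (simp add: R_def)
  have RV: "R \<subseteq> V" using V mt_in by (simp add: R_def)
  have disj: "R \<inter> mt ` R = {}"
    using mtR mt_neq[OF V(1)] mt_neq[OF V(2)] mt_swap[OF V(1,2)] \<open>y \<noteq> mt x\<close>
    by (auto simp: R_def)
  have cS: "closed S" using S_def RV by (rule closed_Diff_mt)
  have "R \<union> S = V - {x, y}" using mtR RV disj by (auto simp: S_def)
  then have bad: "\<not> pm ({mt x, mt y} \<union> S)" using npm by (simp add: R_def)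
  have pq: "mt x \<in> V" "mt y \<in> V" "mt x \<notin> S" "mt y \<notin> S" "mt x \<noteq> mt y"
    using V mt_in mt_inj by (auto simp: S_def R_def)
  note two = no_pm_two[OF cS pq bad]
  have mtS: "mt z \<in> S" if "z \<in> S" for z using that cS by (simp add: closed_def)
  have "transversal (R \<union> {z \<in> S. \<not> adj (mt x) z})"
    using two(1) mtS by (intro transversal_Un[OF S_def RV disj]) auto
  then show ?thesis using two(3) by (auto simp: R_def)
qed

text \<open>Both ends of the matching edge at \<open>a\<close> are deleted, so only \<open>p\<close>
  and \<open>q\<close> are exposed. A transversal still has to contain one end of that edge;
  \<open>a\<close> enters as a placeholder and becomes the omitted vertex.\<close>

lemma no_pm_avoiding_edge:
  assumes V: "a \<in> V" "p \<in> V" "q \<in> V" "a \<noteq> p" "a \<noteq> q" "p \<noteq> q"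
    and disj: "{a, p, q} \<inter> {mt a, mt p, mt q} = {}"
    and no: "\<not> pm (V - {a, mt a, mt p, mt q})"
  shows "\<exists>W. transversal W \<and> a \<in> W \<and> indep (W - {a}) \<and> {a, mt a, mt p, mt q} \<inter> (W - {a}) = {}"
proof -
  define R where "R = {a, p, q}"
  define S where "S = V - R - mt ` R"
  have RV: "R \<subseteq> V" using V by (simp add: R_def)
  have d: "R \<inter> mt ` R = {}" using disj by (simp add: R_def)
  have cS: "closed S" using S_def RV by (rule closed_Diff_mt)
  have "{p, q} \<union> S = V - {a, mt a, mt p, mt q}"
    using V disj by (auto simp: S_def R_def)
  then have bad: "\<not> pm ({p, q} \<union> S)" using no by simp
  have pq: "p \<in> V" "q \<in> V" "p \<notin> S" "q \<notin> S" "p \<noteq> q" using V by (auto simp: S_def R_def)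
  note two = no_pm_two[OF cS pq bad]
  define N where "N = {z \<in> S. \<not> adj p z}"
  have mtS: "mt z \<in> S" if "z \<in> S" for z using that cS by (simp add: closed_def)
  have W: "transversal (R \<union> N)"
    using two(1) mtS by (intro transversal_Un[OF S_def RV d]) (auto simp: N_def)
  have eq: "R \<union> N - {a} = {p, q} \<union> N" using V by (auto simp: R_def N_def S_def)
  then have "indep (R \<union> N - {a})" using two(3) by (simp add: N_def)
  moreover have "{a, mt a, mt p, mt q} \<inter> (R \<union> N - {a}) = {}"
    unfolding eq using V disj by (auto simp: N_def S_def R_def)
  moreover have "a \<in> R \<union> N" by (simp add: R_def)
  ultimately show ?thesis using W by blast
qed

text \<open>The disjointness clauses record that both edges avoid the relevant part of
  \<open>W\<close>; they later supply the two independent edges in its complement.\<close>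

lemma nonextendable_two_edges:
  assumes e: "adj a b" "adj c d" "{a, b} \<inter> {c, d} = {}"
    and no: "\<not> (\<exists>P. perfect_matching V E P \<and> {{a, b}, {c, d}} \<subseteq> P)"
  shows "\<exists>W. transversal W \<and> ((\<exists>t\<in>W. indep (W - {t}) \<and> {a, b, c, d} \<inter> (W - {t}) = {}) \<or>
    one_triangle W \<and> {a, b, c, d} \<inter> W = {})"
    (is "\<exists>W. ?good W")
proof -
  have V: "a \<in> V" "b \<in> V" "c \<in> V" "d \<in> V" and ne: "a \<noteq> b" "c \<noteq> d"
    using e(1,2)[THEN adj_D(1)] e(1,2)[THEN adj_D(2)] e(1,2)[THEN adj_D(3)] by simp_all
  have ne': "a \<noteq> c" "a \<noteq> d" "b \<noteq> c" "b \<noteq> d" using e(3) by auto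
  have npm: "\<not> pm (V - {a, b, c, d})"
  proof -
    have "{c, d} \<inter> {a, b} = {}" using e(3) by (simp only: Int_commute)
    then have "matching E {{a, b}, {c, d}}" using e by (simp add: matching_def adj_def del: disjoint_insert insert_disjoint)
    moreover have "\<Union>{{a, b}, {c, d}} = {a, b, c, d}" by blast
    ultimately show ?thesis using extend_matching[of "{{a, b}, {c, d}}"] no V by auto
  qed
  have mtn: "mt a \<noteq> a" "mt b \<noteq> b" "mt c \<noteq> c" "mt d \<noteq> d" using mt_neq V by blast+
  have cV: "closed V" using mt_in by (simp add: closed_def)
  \<comment> \<open>Here some matching edge has both ends among the four endpoints, so that at most
    two vertices are exposed. If the other two endpoints are partners as well, none is exposed and
    the edges extend.\<close>
  have two: "\<exists>W. ?good W" if xy: "x \<in> V" "y \<in> V" "z \<in> V" "{x, mt x, y, z} = {a, b, c, d}"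
      "distinct [x, mt x, y, z]" for x y z
  proof (cases "z = mt y")
    case True
    have "closed (V - {x, mt x} - {y, mt y})" using cV xy by (intro closed_diff_pair)
    moreover have "V - {x, mt x} - {y, mt y} = V - {a, b, c, d}" using xy(4) True by blast
    ultimately show ?thesis using pm_closed npm by simp
  next
    case False
    have "x \<noteq> mt y" "x \<noteq> mt z" "mt y \<noteq> mt z" "y \<noteq> mt z" "mt y \<noteq> mt x" "mt z \<noteq> mt x" "mt y \<noteq> y" "mt z \<noteq> z"
      using xy(5) False mt_swap[OF xy(1,2)] mt_swap[OF xy(1,3)] mt_swap[OF xy(2,3)]
        mt_inj[OF xy(1,2)] mt_inj[OF xy(1,3)] mt_inj[OF xy(2,3)] mt_neq[OF xy(2)] mt_neq[OF xy(3)] by auto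
    then have "\<exists>W. transversal W \<and> x \<in> W \<and> indep (W - {x}) \<and>
        {x, mt x, mt (mt y), mt (mt z)} \<inter> (W - {x}) = {}"
      using xy(1-3,5) mt_in False mt_mt npm xy(4)
      by (intro no_pm_avoiding_edge) auto
    then show ?thesis using mt_mt xy(2-4) by auto
  qed
  consider "{mt a, mt b, mt c, mt d} \<inter> {a, b, c, d} = {}" | "b = mt a" | "d = mt c"
    | "c = mt a" | "d = mt a" | "c = mt b" | "d = mt b"
    using mtn mt_swap[OF V(1,2)] mt_swap[OF V(1,3)] mt_swap[OF V(1,4)]
      mt_swap[OF V(2,3)] mt_swap[OF V(2,4)] mt_swap[OF V(3,4)] by auto
  then show ?thesis
  proof cases
    case 1
    define R where "R = mt ` {a, b, c, d}"
    have "inj_on mt {a, b, c, d}" using V by (intro inj_on_mt) simp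
    then have cR: "card R = 4" using ne ne' by (simp add: R_def card_image)
    have RV: "R \<subseteq> V" using V mt_in by (simp add: R_def)
    have mtR: "mt ` R = {a, b, c, d}" using V mt_mt by (simp add: R_def)
    have d: "R \<inter> mt ` R = {}" using 1 mtR by (simp add: R_def)
    have "R \<union> (V - R - mt ` R) = V - {a, b, c, d}" using RV d mtR by blast
    then have "\<not> pm (R \<union> (V - R - mt ` R))" using npm by simp
    then obtain W where W: "transversal W" "R \<subseteq> W" "(\<exists>t\<in>W. indep (W - {t})) \<or> one_triangle W"
      using no_pm_four[OF refl cR RV d] by blast
    \<comment> \<open>The four endpoints are the partners of \<open>R\<close>, and \<open>W\<close>
      contains \<open>R\<close>, so the transversal excludes them.\<close>
    have "mt ` R \<inter> W = {}" using W(1,2) RV unfolding transversal_def by blast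
    then have "{a, b, c, d} \<inter> W = {}" using mtR by simp
    then show ?thesis using W by blast
  next
    case 2
    then show ?thesis using two[of a c d] V ne ne' by auto
  next
    case 3
    have "{c, mt c, a, b} = {a, b, c, d}" using 3 by blast
    then show ?thesis using two[of c a b] V ne ne' 3 by auto
  next
    case 4
    have "{a, mt a, b, d} = {a, b, c, d}" using 4 by blast
    then show ?thesis using two[of a b d] V ne ne' 4 by auto
  next
    case 5
    have "{a, mt a, b, c} = {a, b, c, d}" using 5 by blast
    then show ?thesis using two[of a b c] V ne ne' 5 by auto
  next
    case 6
    have "{b, mt b, a, d} = {a, b, c, d}" using 6 by blast
    then show ?thesis using two[of b a d] V ne ne' 6 by auto
  next
    case 7
    have "{b, mt b, a, c} = {a, b, c, d}" using 7 by blast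
    then show ?thesis using two[of b a c] V ne ne' 7 by auto
  qed
qed

section \<open>The triangle condition and extendability in terms of adjacency\<close>

lemma one_triangleE:
  assumes "one_triangle W"
  obtains a b c where "a \<in> W" "b \<in> W" "c \<in> W" "adj a b" "adj b c" "adj a c"
    "\<forall>x\<in>W. \<forall>y\<in>W. adj x y \<longrightarrow> {x, y} \<subseteq> {a, b, c}"
proof -
  obtain a b c where "a \<in> W \<and> b \<in> W \<and> c \<in> W \<and> adj a b \<and> adj b c \<and> adj a c \<and>
     (\<forall>x\<in>W. \<forall>y\<in>W. adj x y \<longrightarrow> {x, y} \<subseteq> {a, b, c})"
    using assms unfolding one_triangle_def by (elim exE)
  then show thesis by (intro that[of a b c]) simp_all
qed

lemma one_triangle_iff:
  "one_triangle W \<longleftrightarrow> (\<exists>a b c. a \<in> W \<and> b \<in> W \<and> c \<in> W \<and> a \<noteq> b \<and> b \<noteq> c \<and> a \<noteq> c \<and>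
     induced_edges E W = {{a, b}, {b, c}, {a, c}})"
proof
  assume "one_triangle W"
  then obtain a b c where abc: "a \<in> W" "b \<in> W" "c \<in> W" "adj a b" "adj b c" "adj a c"
    and only: "\<forall>x\<in>W. \<forall>y\<in>W. adj x y \<longrightarrow> {x, y} \<subseteq> {a, b, c}"
    by (rule one_triangleE)
  note only = only[rule_format]
  have ne: "a \<noteq> b" "b \<noteq> c" "a \<noteq> c" using abc(4-6)[THEN adj_D(3)] by simp_all
  have "induced_edges E W = {{a, b}, {b, c}, {a, c}}"
  proof
    show "{{a, b}, {b, c}, {a, c}} \<subseteq> induced_edges E W"
      using abc by (simp add: induced_edges_def adj_def)
    show "induced_edges E W \<subseteq> {{a, b}, {b, c}, {a, c}}"
    proof
      fix e assume e: "e \<in> induced_edges E W"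
      then have "e \<in> E" "e \<subseteq> W" by (simp_all add: induced_edges_def)
      then obtain x y where xy: "x \<noteq> y" "e = {x, y}" "adj x y" using edgeE by metis
      then have "{x, y} \<subseteq> {a, b, c}" using \<open>e \<subseteq> W\<close> by (intro only) auto
      then show "e \<in> {{a, b}, {b, c}, {a, c}}" using xy(1,2) by (auto simp: insert_commute)
    qed
  qed
  then show "\<exists>a b c. a \<in> W \<and> b \<in> W \<and> c \<in> W \<and> a \<noteq> b \<and> b \<noteq> c \<and> a \<noteq> c \<and>
     induced_edges E W = {{a, b}, {b, c}, {a, c}}" using abc ne by blast
next
  assume "\<exists>a b c. a \<in> W \<and> b \<in> W \<and> c \<in> W \<and> a \<noteq> b \<and> b \<noteq> c \<and> a \<noteq> c \<and>
     induced_edges E W = {{a, b}, {b, c}, {a, c}}"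
  then obtain a b c where abc: "a \<in> W" "b \<in> W" "c \<in> W"
    and eq: "induced_edges E W = {{a, b}, {b, c}, {a, c}}" by blast
  have "{a, b} \<in> induced_edges E W" "{b, c} \<in> induced_edges E W" "{a, c} \<in> induced_edges E W"
    unfolding eq by simp_all
  then have adj: "adj a b" "adj b c" "adj a c" by (simp_all add: induced_edges_def adj_def)
  have "{x, y} \<subseteq> {a, b, c}" if "x \<in> W" "y \<in> W" "adj x y" for x y
  proof -
    have "{x, y} \<in> induced_edges E W" using that by (simp add: induced_edges_def adj_def)
    then show ?thesis unfolding eq by auto
  qed
  then show "one_triangle W" unfolding one_triangle_def using abc adj by blast
qed

text \<open>Connectedness and a perfect matching come from the locale, and the bound on
  \<open>card V\<close> is \<open>2 * l + 2\<close> for \<open>l = 1\<close>; what remains is the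
  clause on matchings of size one.\<close>

lemma extendable_1_iff:
  assumes "card V \<ge> 4"
  shows "extendable 1 V E \<longleftrightarrow> (\<forall>x y. adj x y \<longrightarrow> (\<exists>P. perfect_matching V E P \<and> {{x, y}} \<subseteq> P))"
proof
  assume ext: "extendable 1 V E"
  show "\<forall>x y. adj x y \<longrightarrow> (\<exists>P. perfect_matching V E P \<and> {{x, y}} \<subseteq> P)"
  proof (intro allI impI)
    fix x y assume "adj x y"
    then have "matching E {{x, y}}" "card {{x, y}} = 1" by (simp_all add: matching_def adj_def)
    then show "\<exists>P. perfect_matching V E P \<and> {{x, y}} \<subseteq> P"
      using ext unfolding extendable_def by blast
  qed
next
  assume R: "\<forall>x y. adj x y \<longrightarrow> (\<exists>P. perfect_matching V E P \<and> {{x, y}} \<subseteq> P)"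
  have "has_perfect_matching V E" using pm_closed[of V] mt_in by (simp add: closed_def pm_def)
  moreover have "\<exists>P. perfect_matching V E P \<and> N \<subseteq> P" if N: "matching E N" "card N = 1" for N
  proof -
    obtain e where e: "N = {e}" using N(2) by (rule card_1_singletonE)
    then have "e \<in> E" using N(1) by (simp add: matching_def)
    then obtain x y where "e = {x, y}" "adj x y" by (rule edgeE)
    then show ?thesis using R e by blast
  qed
  ultimately show "extendable 1 V E" using connected assms by (simp add: extendable_def)
qed

lemma extendable_2_iff:
  assumes "card V \<ge> 6"
  shows "extendable 2 V E \<longleftrightarrow> (\<forall>a b c d. adj a b \<longrightarrow> adj c d \<longrightarrow> {a, b} \<inter> {c, d} = {} \<longrightarrow>
    (\<exists>P. perfect_matching V E P \<and> {{a, b}, {c, d}} \<subseteq> P))"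
proof
  assume ext: "extendable 2 V E"
  show "\<forall>a b c d. adj a b \<longrightarrow> adj c d \<longrightarrow> {a, b} \<inter> {c, d} = {} \<longrightarrow>
    (\<exists>P. perfect_matching V E P \<and> {{a, b}, {c, d}} \<subseteq> P)"
  proof (intro allI impI)
    fix a b c d assume *: "adj a b" "adj c d" "{a, b} \<inter> {c, d} = {}"
    have "{c, d} \<inter> {a, b} = {}" using *(3) by (simp only: Int_commute)
    then have "matching E {{a, b}, {c, d}}"
      using * by (simp add: matching_def adj_def del: disjoint_insert insert_disjoint)
    moreover have "{a, b} \<noteq> {c, d}" using *(3) by auto
    then have "card {{a, b}, {c, d}} = 2" by simp
    ultimately show "\<exists>P. perfect_matching V E P \<and> {{a, b}, {c, d}} \<subseteq> P"
      using ext unfolding extendable_def by blast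
  qed
next
  assume R: "\<forall>a b c d. adj a b \<longrightarrow> adj c d \<longrightarrow> {a, b} \<inter> {c, d} = {} \<longrightarrow>
    (\<exists>P. perfect_matching V E P \<and> {{a, b}, {c, d}} \<subseteq> P)"
  have "has_perfect_matching V E" using pm_closed[of V] mt_in by (simp add: closed_def pm_def)
  moreover have "\<exists>P. perfect_matching V E P \<and> N \<subseteq> P" if N: "matching E N" "card N = 2" for N
  proof -
    obtain e e' where e: "N = {e, e'}" "e \<noteq> e'" using N(2) by (auto simp: card_2_iff)
    then have "e \<in> E" "e' \<in> E" "e \<inter> e' = {}" using N(1) by (simp_all add: matching_def)
    moreover obtain a b where "e = {a, b}" "adj a b" using \<open>e \<in> E\<close> by (rule edgeE)
    moreover obtain c d where "e' = {c, d}" "adj c d" using \<open>e' \<in> E\<close> by (rule edgeE)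
    ultimately show ?thesis using R e(1) by blast
  qed
  ultimately show "extendable 2 V E" using connected assms by (simp add: extendable_def)
qed

section \<open>Counting obstructions and independent transversals\<close>

lemma card_edge: "e \<in> E \<Longrightarrow> card e = 2"
  by (erule edgeE) simp

lemma card_two_edges: "e1 \<in> E \<Longrightarrow> e2 \<in> E \<Longrightarrow> e1 \<inter> e2 = {} \<Longrightarrow> card (e1 \<union> e2) = 4"
  using card_edge[of e1] card_edge[of e2]
  by (subst card_Un_disjoint) (simp_all add: card_ge_0_finite)

text \<open>\<open>I\<close> has half of the vertices, and all their partners under \<open>P\<close>
  lie in the other half. This fills it, leaving no room for an edge inside.\<close>

lemma indep_transversal_blocks:
  assumes I: "transversal I" "indep I" and P: "perfect_matching V E P"
    and e: "e \<in> P" "e \<subseteq> V - I"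
  shows False
proof -
  have eE: "e \<in> E" using P e(1) unfolding perfect_matching_def matching_def by blast
  have "card I + card (\<Union>{e}) \<le> card (V - I)"
  proof (rule card_le_by_matching[OF simple P])
    fix x y assume "x \<in> I" "{x, y} \<in> E"
    then show "y \<in> V - I" using I(2) adj_D(2)[of x y] unfolding indep_def adj_def by blast
  qed (use e I in \<open>auto simp: transversal_def\<close>)
  then show False using card_edge[OF eE] card_transversal(2)[OF I(1)] by simp
qed

text \<open>The \<open>card W - 3\<close> vertices off the triangle have their partners outside
  \<open>W\<close>. Together with the four endpoints they would need \<open>card W + 1\<close>
  vertices there, one too many.\<close>

lemma triangle_blocks:
  assumes W: "transversal W" "one_triangle W" and P: "perfect_matching V E P"
    and e: "e1 \<in> P" "e2 \<in> P" "e1 \<inter> e2 = {}" "e1 \<union> e2 \<subseteq> V - W"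
  shows False
proof -
  obtain a b c where abc: "a \<in> W" "b \<in> W" "c \<in> W" "adj a b" "adj b c" "adj a c"
    and only: "\<forall>x\<in>W. \<forall>y\<in>W. adj x y \<longrightarrow> {x, y} \<subseteq> {a, b, c}"
    using W(2) by (rule one_triangleE)
  note only = only[rule_format]
  have eE: "e1 \<in> E" "e2 \<in> E" using P e(1,2) unfolding perfect_matching_def matching_def by blast+
  have WV: "W \<subseteq> V" using W(1) by (simp add: transversal_def)
  have "card (W - {a, b, c}) + card (\<Union>{e1, e2}) \<le> card (V - W)"
  proof (rule card_le_by_matching[OF simple P])
    fix x y assume xy: "x \<in> W - {a, b, c}" "{x, y} \<in> E"
    then show "y \<in> V - W" using only[of x y] adj_D(2)[of x y] unfolding adj_def by blast
  qed (use e WV in auto)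
  then have "card (W - {a, b, c}) + 4 \<le> card W"
    using card_two_edges[OF eE e(3)] card_transversal(2)[OF W(1)] by simp
  moreover have "card W - card {a, b, c} \<le> card (W - {a, b, c})"
    by (rule diff_card_le_card_Diff) simp
  moreover have "card {a, b, c} \<le> 3" by (simp add: card_insert_if)
  ultimately show False by linarith
qed

text \<open>The \<open>card W - 1\<close> partners and the four endpoints would have to share the
  \<open>card W + 1\<close> vertices outside \<open>W - {t}\<close>.\<close>

lemma near_indep_blocks:
  assumes W: "transversal W" "t \<in> W" "indep (W - {t})" and P: "perfect_matching V E P"
    and e: "e1 \<in> P" "e2 \<in> P" "e1 \<inter> e2 = {}" "e1 \<union> e2 \<subseteq> V - (W - {t})"
  shows False
proof -
  have eE: "e1 \<in> E" "e2 \<in> E" using P e(1,2) unfolding perfect_matching_def matching_def by blast+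
  have WV: "W \<subseteq> V" using W(1) by (simp add: transversal_def)
  have fW: "finite W" using WV finite_V finite_subset by blast
  have "card (W - {t}) + card (\<Union>{e1, e2}) \<le> card (V - (W - {t}))"
  proof (rule card_le_by_matching[OF simple P])
    fix x y assume xy: "x \<in> W - {t}" "{x, y} \<in> E"
    then show "y \<in> V - (W - {t})"
      using W(3) adj_D(2)[of x y] unfolding indep_def adj_def by blast
  qed (use e WV in auto)
  moreover have "V - (W - {t}) = insert t (V - W)" using W(2) WV by blast
  moreover have "card (insert t (V - W)) = Suc (card W)"
    using card_transversal(2)[OF W(1)] W(2) finite_V by simp
  moreover have "card (W - {t}) = card W - 1" using W(2) fW by simp
  ultimately show False using card_two_edges[OF eE e(3)] by simp
qed

lemma transversal_mem: "transversal I \<Longrightarrow> x \<in> V \<Longrightarrow> x \<in> I \<or> mt x \<in> I"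
  unfolding transversal_def by blast

text \<open>Since \<open>card W \<ge> 4\<close>, some \<open>d\<close> in \<open>W\<close> lies off
  the triangle and is isolated within \<open>W\<close>. The 4-cycles then make \<open>d\<close>
  adjacent to \<open>mt w\<close> and \<open>mt d\<close> adjacent to \<open>w\<close> for every
  other \<open>w\<close> in \<open>W\<close>, so the end of this pair chosen by \<open>I\<close>
  decides all the others.\<close>

lemma no_indep_transversal_if_triangle:
  assumes W: "transversal W" "one_triangle W" "card W \<ge> 4"
    and e: "e \<in> E" "e \<subseteq> V - W" and I: "transversal I" "indep I"
  shows False
proof -
  obtain a b c where abc: "a \<in> W" "b \<in> W" "c \<in> W" "adj a b" "adj b c" "adj a c"
    and only: "\<forall>x\<in>W. \<forall>y\<in>W. adj x y \<longrightarrow> {x, y} \<subseteq> {a, b, c}"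
    using W(2) by (rule one_triangleE)
  note only = only[rule_format]
  have WV: "x \<in> V" if "x \<in> W" for x using W(1) that by (auto simp: transversal_def)
  have "card {a, b, c} \<le> 3" by (simp add: card_insert_if)
  then have "\<not> W \<subseteq> {a, b, c}" using W(3) card_mono[of "{a, b, c}" W] by (cases "W \<subseteq> {a, b, c}") simp_all
  then obtain d where d: "d \<in> W" "d \<notin> {a, b, c}" by blast
  have dw: "adj d (mt w)" "adj (mt d) w" if w: "w \<in> W" "w \<noteq> d" for w
  proof -
    have "\<not> adj d w" using only[OF d(1) w(1)] d(2) by blast
    moreover have "w \<noteq> mt d" using d(1) w(1) WV W(1) unfolding transversal_def by blast
    ultimately show "adj d (mt w)" "adj (mt d) w"
      using square_adj[OF WV[OF d(1)] WV[OF w(1)] w(2)] by blast+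
  qed
  consider "d \<in> I" | "mt d \<in> I" using transversal_mem[OF I(1) WV[OF d(1)]] by blast
  then show False
  proof cases
    case 1
    have "w \<in> I" if "w \<in> W" for w
      using 1 that dw(1)[OF that] I(2) transversal_mem[OF I(1) WV[OF that]]
      unfolding indep_def by blast
    then show False using abc I(2) unfolding indep_def by blast
  next
    case 2
    have "mt w \<in> I" if "w \<in> W" for w
      using 2 that dw(2)[OF that] I(2) transversal_mem[OF I(1) WV[OF that]]
      unfolding indep_def by blast
    then have "mt ` W \<subseteq> I" by (rule image_subsetI)
    then have "V - W \<subseteq> I" unfolding mt_transversal[OF W(1)] .
    then have "e \<subseteq> I" using e(2) by blast
    then show False using e(1) I(2) by (auto simp: indep_iff independent_set_def)
  qed
qed

text \<open>Distinct \<open>w\<close>, \<open>w'\<close> in \<open>W - {t}\<close> are not adjacent,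
  so the 4-cycle joins \<open>w\<close> to \<open>mt w'\<close>. Hence \<open>I\<close> contains all
  of \<open>W - {t}\<close> or none of it. In the first case \<open>x\<close> forbids
  \<open>t\<close> and \<open>y\<close> forbids \<open>mt t\<close>.\<close>

lemma no_indep_transversal_if_near:
  assumes W: "transversal W" "t \<in> W" "indep (W - {t})" "card W \<ge> 3"
    and e: "e1 \<in> E" "e2 \<in> E" "e1 \<inter> e2 = {}" "e1 \<union> e2 \<subseteq> V - (W - {t})"
    and x: "x \<in> W - {t}" "adj x t" and y: "y \<in> W - {t}" "adj y (mt t)"
    and I: "transversal I" "indep I"
  shows False
proof -
  have WV: "w \<in> V" if "w \<in> W" for w using W(1) that by (auto simp: transversal_def)
  have cross: "adj w (mt w')" if w: "w \<in> W - {t}" "w' \<in> W - {t}" "w \<noteq> w'" for w w'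
  proof -
    have "\<not> adj w w'" using W(3) w unfolding indep_def by blast
    moreover have "w' \<noteq> mt w" using w WV W(1) unfolding transversal_def by blast
    ultimately show ?thesis using square_adj[of w w'] WV w by blast
  qed
  have ti: "t \<in> I \<or> mt t \<in> I" using transversal_mem[OF I(1) WV[OF W(2)]] .
  show False
  proof (cases "\<exists>w\<in>W - {t}. w \<in> I")
    case True
    then obtain w where w: "w \<in> W - {t}" "w \<in> I" by blast
    have other: "w' \<in> I" if w': "w' \<in> W - {t}" "w' \<noteq> w" for w'
      using cross[OF w(1) w'(1)] w' w(2) I(2) transversal_mem[OF I(1), of w'] WV
      unfolding indep_def by blast
    then have "W - {t} \<subseteq> I" using w by blast
    then show False using x y ti I(2) unfolding indep_def by blast
  next
    case False
    then have mI: "mt w \<in> I" if "w \<in> W - {t}" for w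
      using that transversal_mem[OF I(1), of w] WV by blast
    have sub: "V - (W - {t}) \<subseteq> I \<union> {t, mt t}"
    proof
      fix z assume "z \<in> V - (W - {t})"
      then have "z = t \<or> z \<in> mt ` W" using mt_transversal[OF W(1)] by blast
      then show "z \<in> I \<union> {t, mt t}" using mI by blast
    qed
    \<comment> \<open>\<open>I\<close> contains \<open>t\<close> or \<open>mt t\<close>, so it
      misses at most one vertex outside \<open>W - {t}\<close>, and disjoint edges cannot both
      contain that vertex.\<close>
    have "e1 \<subseteq> I \<or> e2 \<subseteq> I"
      using sub ti e(3,4) by blast
    then show False using e(1,2) I(2) by (auto simp: indep_iff independent_set_def)
  qed
qed

lemma exchange_transversal:
  assumes "transversal W" "t \<in> W"
  shows "transversal (insert (mt t) (W - {t}))"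
proof -
  have tV: "t \<in> V" using assms unfolding transversal_def by blast
  have "x \<in> insert (mt t) (W - {t}) \<longleftrightarrow> mt x \<notin> insert (mt t) (W - {t})" if x: "x \<in> V" for x
  proof -
    have "mt x = mt t \<longleftrightarrow> x = t" "mt x = t \<longleftrightarrow> x = mt t"
      using mt_inj[OF x tV] mt_swap[OF x tV] by simp_all
    moreover have "x \<in> W \<longleftrightarrow> mt x \<notin> W" "t \<in> W \<longleftrightarrow> mt t \<notin> W"
      using assms(1) x tV unfolding transversal_def by blast+
    ultimately show ?thesis using assms(2) mt_neq[OF tV] by auto
  qed
  moreover have "insert (mt t) (W - {t}) \<subseteq> V"
    using assms(1) mt_in[OF tV] unfolding transversal_def by blast
  ultimately show ?thesis unfolding transversal_def by blast
qed

text \<open>If \<open>t\<close> or \<open>mt t\<close> had no neighbour in \<open>W - {t}\<close>,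
  adding it would give an independent transversal. One of the two disjoint edges misses the added
  vertex, hence lies in the complement and cannot extend.\<close>

lemma near_indep_neighbours:
  assumes W: "transversal W" "t \<in> W" "indep (W - {t})"
    and ext: "\<And>e. e \<in> E \<Longrightarrow> \<exists>P. perfect_matching V E P \<and> e \<in> P"
    and e: "e1 \<in> E" "e2 \<in> E" "e1 \<inter> e2 = {}" "e1 \<union> e2 \<subseteq> V - (W - {t})"
  shows "(\<exists>x\<in>W - {t}. adj x t) \<and> (\<exists>y\<in>W - {t}. adj y (mt t))"
proof -
  \<comment> \<open>Needed for \<open>z = t\<close> and, after exchanging the ends of this pair, for
    \<open>z = mt t\<close>.\<close>
  have "\<exists>x\<in>W - {t}. adj x z" if z: "transversal (insert z (W - {t}))" for z
  proof (rule ccontr)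
    assume "\<not> (\<exists>x\<in>W - {t}. adj x z)"
    moreover have "\<not> adj z z" using adj_D(3) by blast
    ultimately have I: "indep (insert z (W - {t}))"
      using W(3) adj_sym unfolding indep_def by blast
    have "e1 \<subseteq> V - insert z (W - {t}) \<or> e2 \<subseteq> V - insert z (W - {t})"
      using e(3,4) by blast
    then obtain e where e': "e \<in> E" "e \<subseteq> V - insert z (W - {t})" using e by blast
    then obtain P where "perfect_matching V E P" "e \<in> P" using ext by blast
    then show False using indep_transversal_blocks[OF z I] e'(2) by blast
  qed
  moreover have "insert t (W - {t}) = W" using W(2) by blast
  ultimately show ?thesis using W(1) exchange_transversal[OF W(1,2)] by metis
qed

section \<open>The characterisation without indices\<close>

text \<open>The two alternatives of the theorem freed from the enumeration: \<open>W\<close> is the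
  set of all \<open>v i\<close>, while \<open>t\<close> and \<open>mt t\<close> are
  \<open>v n\<close> and \<open>u n\<close>.\<close>

definition blocking :: "'a set \<Rightarrow> bool" where
  "blocking W \<longleftrightarrow> transversal W \<and>
    (card W \<ge> 4 \<and> one_triangle W \<and> two_indep_edges_in E (V - W) \<or>
     (\<exists>t\<in>W. indep (W - {t}) \<and> two_indep_edges_in E (V - (W - {t})) \<and>
       (\<exists>x\<in>W - {t}. adj x t) \<and> (\<exists>y\<in>W - {t}. adj y (mt t))))"

lemma blocking_if_extendable:
  assumes V: "card V \<ge> 6" and ext: "extendable 1 V E" and nonext: "\<not> extendable 2 V E"
  shows "\<exists>W. blocking W"
proof -
  have ext: "\<exists>P. perfect_matching V E P \<and> e \<in> P" if e: "e \<in> E" for e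
  proof -
    obtain x y where xy: "e = {x, y}" "adj x y" using e by (rule edgeE)
    then show ?thesis using ext extendable_1_iff V by auto
  qed
  obtain a b c d where e: "adj a b" "adj c d" "{a, b} \<inter> {c, d} = {}"
    "\<not> (\<exists>P. perfect_matching V E P \<and> {{a, b}, {c, d}} \<subseteq> P)"
    using nonext unfolding extendable_2_iff[OF V] by blast
  have eE: "{a, b} \<in> E" "{c, d} \<in> E" using e by (simp_all add: adj_def)
  have eV: "{a, b} \<union> {c, d} \<subseteq> V"
    using e(1,2)[THEN adj_D(1)] e(1,2)[THEN adj_D(2)] by simp
  obtain W where W: "transversal W"
    and cases: "(\<exists>t\<in>W. indep (W - {t}) \<and> {a, b, c, d} \<inter> (W - {t}) = {}) \<or>
      one_triangle W \<and> {a, b, c, d} \<inter> W = {}"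
    using nonextendable_two_edges[OF e] by blast
  from cases show ?thesis
  proof
    assume "\<exists>t\<in>W. indep (W - {t}) \<and> {a, b, c, d} \<inter> (W - {t}) = {}"
    then obtain t where t: "t \<in> W" "indep (W - {t})" "{a, b, c, d} \<inter> (W - {t}) = {}" by blast
    have sub: "{a, b} \<union> {c, d} \<subseteq> V - (W - {t})" using eV t(3) by blast
    then have "two_indep_edges_in E (V - (W - {t}))"
      using eE e(3) unfolding two_indep_edges_in_def by (metis Un_subset_iff)
    then show ?thesis
      using near_indep_neighbours[OF W t(1,2) ext eE e(3) sub] W t(1,2) unfolding blocking_def by blast
  next
    assume t: "one_triangle W \<and> {a, b, c, d} \<inter> W = {}"
    then have sub: "{a, b} \<union> {c, d} \<subseteq> V - W" using eV by blast
    then have "two_indep_edges_in E (V - W)"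
      using eE e(3) unfolding two_indep_edges_in_def by (metis Un_subset_iff)
    \<comment> \<open>This is the origin of \<open>n \<ge> 4\<close> in (i): the four endpoints lie
      in \<open>V - W\<close>, which is as large as \<open>W\<close>.\<close>
    moreover have "card ({a, b} \<union> {c, d}) \<le> card (V - W)"
      using sub finite_V by (intro card_mono) auto
    then have "4 \<le> card W"
      using card_two_edges[OF eE e(3)] card_transversal(2)[OF W] by simp
    ultimately show ?thesis using W t unfolding blocking_def by blast
  qed
qed

lemma extendable_if_blocking:
  assumes V: "card V \<ge> 6" and W: "blocking W"
  shows "extendable 1 V E \<and> \<not> extendable 2 V E"
proof -
  have tW: "transversal W" using W by (simp add: blocking_def)
  have cW: "card W \<ge> 3" using card_transversal(1)[OF tW] V by simp
  \<comment> \<open>Both alternatives reduce to the same two facts: the absence of independent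
    transversals gives \<open>1\<close>-extendability, and one concrete pair of edges refutes
    \<open>2\<close>-extendability.\<close>
  from W obtain e1 e2 where e: "e1 \<in> E" "e2 \<in> E" "e1 \<inter> e2 = {}"
    and no_indep: "\<not> (\<exists>I. transversal I \<and> indep I)"
    and no_pm: "\<not> (\<exists>P. perfect_matching V E P \<and> {e1, e2} \<subseteq> P)"
  proof -
    consider (triangle) "card W \<ge> 4" "one_triangle W" "two_indep_edges_in E (V - W)"
      | (near) t x y where "t \<in> W" "indep (W - {t})" "two_indep_edges_in E (V - (W - {t}))"
        "x \<in> W - {t}" "adj x t" "y \<in> W - {t}" "adj y (mt t)"
      using W unfolding blocking_def by blast
    then show ?thesis
    proof cases
      case triangle
      obtain e1 e2 where e: "e1 \<in> E" "e2 \<in> E" "e1 \<subseteq> V - W" "e2 \<subseteq> V - W" "e1 \<inter> e2 = {}"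
        using triangle(3) unfolding two_indep_edges_in_def by blast
      show ?thesis
        using that[OF e(1,2,5)] no_indep_transversal_if_triangle[OF tW triangle(2,1) e(1,3)]
          triangle_blocks[OF tW triangle(2) _ _ _ e(5)] e(3,4) by (metis Un_subset_iff insert_subset)
    next
      case near
      obtain e1 e2 where e: "e1 \<in> E" "e2 \<in> E" "e1 \<subseteq> V - (W - {t})" "e2 \<subseteq> V - (W - {t})" "e1 \<inter> e2 = {}"
        using near(3) unfolding two_indep_edges_in_def by blast
      have sub: "e1 \<union> e2 \<subseteq> V - (W - {t})" using e by blast
      show ?thesis
        using that[OF e(1,2,5)] near_indep_blocks[OF tW near(1,2) _ _ _ e(5) sub]
          no_indep_transversal_if_near[OF tW near(1,2) cW e(1,2,5) sub near(4-7)] by (metis insert_subset)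
    qed
  qed
  have "extendable 1 V E"
  proof -
    have "\<exists>P. perfect_matching V E P \<and> {{x, y}} \<subseteq> P" if "adj x y" for x y
      using nonextendable_edge[OF that] no_indep by blast
    then show ?thesis using extendable_1_iff V by simp
  qed
  moreover have "\<not> extendable 2 V E"
  proof
    assume ext: "extendable 2 V E"
    obtain a b where "e1 = {a, b}" "adj a b" using e(1) by (rule edgeE)
    moreover obtain c d where "e2 = {c, d}" "adj c d" using e(2) by (rule edgeE)
    ultimately show False using ext no_pm e(3) unfolding extendable_2_iff[OF V] by blast
  qed
  ultimately show ?thesis by blast
qed

end

section \<open>Enumerations of the matching and the theorem\<close>

text \<open>Writing \<open>P\<close> as an image does not by itself exclude repetitions. Counting
  does: the values of \<open>u\<close> and \<open>v\<close> cover \<open>2 * n\<close> vertices, so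
  both maps are injective on the indices and their images are disjoint.\<close>

lemma indexed_perfect_matching:
  assumes "square_matching V E mt" and "\<And>x. x \<in> V \<Longrightarrow> {x, mt x} \<in> P"
    and "card V = 2 * n" and "\<Union>P = V" and P: "P = (\<lambda>i. {u i, v i}) ` {1..n}"
  shows "inj_on v {1..n}" "\<And>i. i \<in> {1..n} \<Longrightarrow> mt (v i) = u i"
    "square_matching.transversal V mt (v ` {1..n})" "V - v ` {1..n} = u ` {1..n}"
proof -
  interpret square_matching V E mt by fact
  let ?N = "{1..n}"
  have V: "V = u ` ?N \<union> v ` ?N" using P assms(4) by auto
  have le: "card (u ` ?N) \<le> n" "card (v ` ?N) \<le> n" using card_image_le[of ?N] by auto
  have "card (u ` ?N) + card (v ` ?N) = 2 * n + card (u ` ?N \<inter> v ` ?N)"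
    using card_Un_Int[of "u ` ?N" "v ` ?N"] V assms(3) by simp
  then have c: "card (u ` ?N) = n" "card (v ` ?N) = n" "card (u ` ?N \<inter> v ` ?N) = 0"
    using le by linarith+
  then have disj: "u ` ?N \<inter> v ` ?N = {}" by simp
  show inj: "inj_on v ?N" using c by (intro eq_card_imp_inj_on) simp_all
  show mt_v: "mt (v i) = u i" if i: "i \<in> ?N" for i
  proof -
    have vV: "v i \<in> V" using V i by blast
    then obtain j where j: "j \<in> ?N" "{v i, mt (v i)} = {u j, v j}" using assms(2) P by blast
    then have "v i \<noteq> u j" using disj i by blast
    then have "v i = v j" "mt (v i) = u j" using j(2) by (auto simp: doubleton_eq_iff)
    then show ?thesis using inj i j(1) by (metis inj_onD)
  qed
  show Vv: "V - v ` ?N = u ` ?N" using V disj by blast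
  show "transversal (v ` ?N)"
    unfolding transversal_def
  proof (intro conjI ballI)
    show "v ` ?N \<subseteq> V" using V by blast
    fix x assume x: "x \<in> V"
    show "x \<in> v ` ?N \<longleftrightarrow> mt x \<notin> v ` ?N"
    proof (cases "x \<in> v ` ?N")
      case True
      then show ?thesis using mt_v disj by auto
    next
      case False
      then obtain i where i: "i \<in> ?N" "x = u i" using V x by blast
      then have "mt x = v i" using mt_v mt_mt V by (metis UnI2 imageI)
      then show ?thesis using False i by blast
    qed
  qed
qed

theorem theorem4p1:
  fixes V :: "'a set" and E :: "'a set set" and n :: nat
  assumes "simple_graph V E"
    and "n \<ge> 3"
    and "card V = 2 * n"
    and "has_perfect_matching V E"
    and "max_forcing_number V E = n - 1"
  shows "(extendable 1 V E \<and> \<not> extendable 2 V E) \<longleftrightarrow>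
    (\<exists>M u v. perfect_matching V E M \<and> M = (\<lambda>i. {u i, v i}) ` {1..n} \<and>
       forcing_number V E M = n - 1 \<and>
       ((n \<ge> 4 \<and>
         (\<exists>a b c. a \<in> v ` {1..n} \<and> b \<in> v ` {1..n} \<and> c \<in> v ` {1..n} \<and>
            a \<noteq> b \<and> b \<noteq> c \<and> a \<noteq> c \<and>
            induced_edges E (v ` {1..n}) = {{a, b}, {b, c}, {a, c}}) \<and>
         two_indep_edges_in E (u ` {1..n}))
        \<or>
        (independent_set E (v ` {1..n-1}) \<and>
         two_indep_edges_in E (u ` {1..n} \<union> {v n}) \<and>
         (\<exists>i\<in>{1..n-1}. \<exists>j\<in>{1..n-1}. {v i, v n} \<in> E \<and> {v j, u n} \<in> E))))"
    (is "?L \<longleftrightarrow> (\<exists>M u v. ?R M u v)")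
proof
  have V6: "card V \<ge> 6" using assms(2,3) by simp
  assume L: ?L
  obtain P where P: "perfect_matching V E P" "forcing_number V E P = n - 1"
    using max_forcing_number_attained[OF assms(1,4)] assms(5) by metis
  obtain mt where sq: "square_matching V E mt" and mtP: "P = (\<lambda>x. {x, mt x}) ` V"
    using square_matching_partner[OF assms(1) P(1) assms(3) P(2)] by metis
  interpret square_matching V E mt by (rule sq)
  obtain W where W: "blocking W" using blocking_if_extendable[OF V6] L by blast
  then have tW: "transversal W" by (simp add: blocking_def)
  have WV: "W \<subseteq> V" using tW by (simp add: transversal_def)
  then have fW: "finite W" using finite_V finite_subset by blast
  have cW: "card W = n" using card_transversal(1)[OF tW] assms(3) by simp
  \<comment> \<open>Indexed by \<open>V\<close>, every matching edge is listed from both of its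
    ends; the transversal \<open>W\<close> lists each edge once.\<close>
  have matching: "P = (\<lambda>i. {mt (v i), v i}) ` {1..n}" and u: "(\<lambda>i. mt (v i)) ` {1..n} = V - W"
    if v: "v ` {1..n} = W" for v
  proof -
    show "(\<lambda>i. mt (v i)) ` {1..n} = V - W"
      using mt_transversal[OF tW] unfolding v[symmetric] by (simp add: image_image)
    have "V = W \<union> mt ` W" using WV mt_transversal[OF tW] by blast
    then have "P = (\<lambda>x. {x, mt x}) ` (W \<union> mt ` W)" using mtP by (simp only:)
    also have "\<dots> = (\<lambda>x. {x, mt x}) ` W \<union> (\<lambda>x. {mt x, mt (mt x)}) ` W"
      by (simp only: image_Un image_image)
    also have "(\<lambda>x. {mt x, mt (mt x)}) ` W = (\<lambda>x. {mt x, x}) ` W"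
      using mt_mt WV by (intro image_cong) auto
    also have "(\<lambda>x. {x, mt x}) ` W = (\<lambda>x. {mt x, x}) ` W"
      by (simp add: insert_commute)
    finally show "P = (\<lambda>i. {mt (v i), v i}) ` {1..n}"
      unfolding v[symmetric] by (simp add: image_image)
  qed
  from W consider (triangle) "card W \<ge> 4" "one_triangle W" "two_indep_edges_in E (V - W)"
    | (near) t x y where "t \<in> W" "indep (W - {t})" "two_indep_edges_in E (V - (W - {t}))"
      "x \<in> W - {t}" "adj x t" "y \<in> W - {t}" "adj y (mt t)"
    unfolding blocking_def by blast
  then have "\<exists>v. ?R P (\<lambda>i. mt (v i)) v"
  proof cases
    case triangle
    obtain v where "bij_betw v {1..card W} W" using ex_bij_betw_nat_finite_1[OF fW] by blast
    then have v: "v ` {1..n} = W" using cW by (simp add: bij_betw_def)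
    have "?R P (\<lambda>i. mt (v i)) v"
      using P matching[OF v] triangle cW one_triangle_iff[of W] unfolding u[OF v] v by simp
    then show ?thesis by (rule exI[of _ v])
  next
    case near
    have "card (W - {t}) = n - 1" using near(1) fW cW by simp
    then obtain h where "bij_betw h {1..n - 1} (W - {t})"
      using ex_bij_betw_nat_finite_1[of "W - {t}"] fW by auto
    then have h: "h ` {1..n - 1} = W - {t}" by (simp add: bij_betw_def)
    \<comment> \<open>\<open>h\<close> numbers \<open>W - {t}\<close> by \<open>1\<close> to
      \<open>n - 1\<close>, and the last index is reserved for the omitted vertex, as (ii)
      prescribes.\<close>
    define v where "v = h(n := t)"
    have v': "v ` {1..n - 1} = W - {t}"
      unfolding h[symmetric] using assms(2) by (intro image_cong) (auto simp: v_def)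
    have vn: "v n = t" by (simp add: v_def)
    have "{1..n} = insert n {1..n - 1}" using assms(2) by auto
    then have v: "v ` {1..n} = W" using v' vn near(1) by auto
    obtain i where i: "i \<in> {1..n - 1}" "x = v i" using near(4) v' by blast
    obtain j where j: "j \<in> {1..n - 1}" "y = v j" using near(6) v' by blast
    have ij: "{v i, v n} \<in> E" "{v j, mt (v n)} \<in> E" using near(5,7) i j vn by (simp_all add: adj_def)
    have "V - W \<union> {v n} = V - (W - {t})" using near(1) WV vn by blast
    then have "?R P (\<lambda>i. mt (v i)) v"
      using P matching[OF v] near(2,3) i(1) j(1) ij unfolding u[OF v] v' indep_iff by auto
    then show ?thesis by (rule exI[of _ v])
  qed
  then obtain v where R: "?R P (\<lambda>i. mt (v i)) v" by (elim exE)
  show "\<exists>M u v. ?R M u v"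
    by (rule exI[of _ P], rule exI[of _ "\<lambda>i. mt (v i)"], rule exI[of _ v], rule R)
next
  have V6: "card V \<ge> 6" using assms(2,3) by simp
  assume "\<exists>M u v. ?R M u v"
  then obtain P u v where R: "?R P u v" by (elim exE)
  note P = R[THEN conjunct1] R[THEN conjunct2, THEN conjunct2, THEN conjunct1]
    and uv = R[THEN conjunct2, THEN conjunct1]
  obtain mt where sq: "square_matching V E mt" and "P = (\<lambda>x. {x, mt x}) ` V"
    using square_matching_partner[OF assms(1) P(1) assms(3) P(2)] by metis
  then have mtP: "\<And>x. x \<in> V \<Longrightarrow> {x, mt x} \<in> P" by simp
  interpret square_matching V E mt by (rule sq)
  have UP: "\<Union>P = V" using P(1) by (simp add: perfect_matching_def)
  note ind = indexed_perfect_matching[OF sq mtP assms(3) UP uv]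
  define W where "W = v ` {1..n}"
  have tW: "transversal W" and u: "u ` {1..n} = V - W" using ind(3,4) by (simp_all add: W_def)
  have cW: "card W = n" using card_transversal(1)[OF tW] assms(3) by simp
  have n: "{1..n} = insert n {1..n - 1}" "n \<in> {1..n}" "n \<notin> {1..n - 1}" using assms(2) by auto
  have vn: "v n \<in> W" using n(2) by (simp add: W_def)
  \<comment> \<open>By injectivity, dropping the index \<open>n\<close> removes exactly the vertex
    \<open>v n\<close> from \<open>W\<close>, so \<open>v n\<close> can play the role of
    \<open>t\<close>.\<close>
  have "v n \<notin> v ` {1..n - 1}"
    using inj_on_image_mem_iff[OF ind(1) n(2), of "{1..n - 1}"] n(3) by auto
  then have v': "v ` {1..n - 1} = W - {v n}" unfolding W_def n(1) by auto
  have u': "u ` {1..n} \<union> {v n} = V - (W - {v n})"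
    using u vn tW unfolding transversal_def by blast
  have mtn: "mt (v n) = u n" using ind(2) n(2) by blast
  have "blocking W"
    using R[THEN conjunct2, THEN conjunct2, THEN conjunct2]
  proof (elim conjE disjE)
    assume n4: "n \<ge> 4" and two: "two_indep_edges_in E (u ` {1..n})"
      and tri: "\<exists>a b c. a \<in> v ` {1..n} \<and> b \<in> v ` {1..n} \<and> c \<in> v ` {1..n} \<and>
            a \<noteq> b \<and> b \<noteq> c \<and> a \<noteq> c \<and>
            induced_edges E (v ` {1..n}) = {{a, b}, {b, c}, {a, c}}"
    have "one_triangle W" unfolding one_triangle_iff W_def by (rule tri)
    then show ?thesis using tW cW n4 two unfolding blocking_def u by simp
  next
    assume i: "independent_set E (v ` {1..n-1})"
      and two: "two_indep_edges_in E (u ` {1..n} \<union> {v n})"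
      and "\<exists>i\<in>{1..n-1}. \<exists>j\<in>{1..n-1}. {v i, v n} \<in> E \<and> {v j, u n} \<in> E"
    then obtain i j where ij: "i \<in> {1..n-1}" "j \<in> {1..n-1}" "{v i, v n} \<in> E" "{v j, u n} \<in> E"
      by (elim bexE conjE)
    have "v i \<in> W - {v n}" "v j \<in> W - {v n}" using ij(1,2) v' by blast+
    moreover have "adj (v i) (v n)" "adj (v j) (mt (v n))" using ij(3,4) mtn by (simp_all add: adj_def)
    ultimately show ?thesis
      using i two tW vn unfolding v' u' indep_iff[symmetric] blocking_def by blast
  qed
  then show ?L by (rule extendable_if_blocking[OF V6])
qed

end
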